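(* Suppose $\sigma$ is an uncountable regular cardinal, $\mu$ is a singular cardinal with $\mathrm{cf}(\mu)\geq\sigma$, and $\mathrm{pp}_{\Gamma(\mu,\sigma)}(\mu)$ is a weakly inaccessible cardinal $\kappa$. Then $\kappa\in\mathrm{PP}_{\Gamma(\mu,\sigma)}(\mu)$.
   Context: $\mathrm{Reg}$ denotes the class of regular cardinals. For a set $A$ of regular cardinals, $\prod A$ is the set of functions $f$ on $A$ with $f(a)<a$; $\mathrm{tcf}(\prod A/J)=\lambda$ means there is a sequence $\langle f_\alpha:\alpha<\lambda\rangle$ in $\prod A$, increasing modulo the ideal $J$ and cofinal in $\prod A$ modulo $J$. An ideal is $\sigma$-complete if closed under unions of fewer than $\sigma$ sets. For $\mu$ singular and $\sigma=\mathrm{cf}(\sigma)\leq\mathrm{cf}(\mu)<\theta\leq\mu$, $\mathrm{PP}_{\Gamma(\theta,\sigma)}(\mu)$ is the set of cardinals $\lambda$ such that there are a cofinal $A\subseteq\mu\cap\mathrm{Reg}$ with $|A|<\theta$ and a $\sigma$-complete ideal $J$ on $A$ containing all bounded subsets of $A$ with $\lambda=\mathrm{tcf}(\prod A/J)$; $\mathrm{pp}_{\Gamma(\theta,\sigma)}(\mu)=\sup\mathrm{PP}_{\Gamma(\theta,\sigma)}(\mu)$. (Here $\theta=\mu$.) *)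

theory Defs
  imports "HOL-Library.FuncSet"
begin

unbundle cardinal_syntax

text \<open>
  Cardinals are well-order relations satisfying \<^const>\<open>Card_order\<close>, compared by \<open>\<le>o\<close>, \<open><o\<close>, \<open>=o\<close>.
  The ordinals below a cardinal \<open>\<mu>\<close> are the elements of \<open>Field \<mu>\<close>; such an \<open>a\<close> stands for
  the order type of its initial segment \<open>underS \<mu> a\<close>.
\<close>

definition infinite_regular :: "'a rel \<Rightarrow> bool" where
  "infinite_regular r \<longleftrightarrow> Cinfinite r \<and> regularCard r"

definition singular :: "'a rel \<Rightarrow> bool" where
  "singular r \<longleftrightarrow> Cinfinite r \<and> \<not> regularCard r"

definition cofinality :: "'a rel \<Rightarrow> 'a rel" where
  "cofinality r = (SOME c. \<exists>K. c = |K| \<and> K \<subseteq> Field r \<and> cofinal K r \<and>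
                              (\<forall>L. L \<subseteq> Field r \<and> cofinal L r \<longrightarrow> |K| \<le>o |L| ))"

definition weakly_inaccessible :: "'a rel \<Rightarrow> bool" where
  "weakly_inaccessible r \<longleftrightarrow> Card_order r \<and> natLeq <o r \<and> regularCard r \<and>
     (\<forall>s :: 'a rel. Card_order s \<and> s <o r \<longrightarrow> cardSuc s <o r)"

definition Reg_below :: "'a rel \<Rightarrow> 'a set" where
  "Reg_below \<mu> = {a \<in> Field \<mu>. infinite_regular (Restr \<mu> (underS \<mu> a))}"

text \<open>Ideals are proper: modulo an improper ideal every sequence is increasing and cofinal.\<close>

definition proper_ideal_on :: "'a set \<Rightarrow> 'a set set \<Rightarrow> bool" where
  "proper_ideal_on A J \<longleftrightarrow> J \<subseteq> Pow A \<and> {} \<in> J \<and> A \<notin> J \<and>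
     (\<forall>X\<in>J. \<forall>Y. Y \<subseteq> X \<longrightarrow> Y \<in> J) \<and> (\<forall>X\<in>J. \<forall>Y\<in>J. X \<union> Y \<in> J)"

definition complete_ideal :: "'b rel \<Rightarrow> 'a set set \<Rightarrow> bool" where
  "complete_ideal \<sigma> J \<longleftrightarrow> (\<forall>F. F \<subseteq> J \<and> |F| <o \<sigma> \<longrightarrow> \<Union>F \<in> J)"

definition less_mod :: "'a rel \<Rightarrow> 'a set \<Rightarrow> 'a set set \<Rightarrow> ('a \<Rightarrow> 'a) \<Rightarrow> ('a \<Rightarrow> 'a) \<Rightarrow> bool" where
  "less_mod \<mu> A J f g \<longleftrightarrow> {a \<in> A. \<not> (f a \<noteq> g a \<and> (f a, g a) \<in> \<mu>)} \<in> J"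

definition le_mod :: "'a rel \<Rightarrow> 'a set \<Rightarrow> 'a set set \<Rightarrow> ('a \<Rightarrow> 'a) \<Rightarrow> ('a \<Rightarrow> 'a) \<Rightarrow> bool" where
  "le_mod \<mu> A J f g \<longleftrightarrow> {a \<in> A. (f a, g a) \<notin> \<mu>} \<in> J"

text \<open>
  The product of \<open>A\<close>, a set of ordinals below \<open>\<mu>\<close>, is \<open>Pi\<^sub>E A (underS \<mu>)\<close>. As usual a true
  cofinality is a regular cardinal; this is what makes it unique.
\<close>

definition is_tcf :: "'a rel \<Rightarrow> 'a set \<Rightarrow> 'a set set \<Rightarrow> 'l rel \<Rightarrow> bool" where
  "is_tcf \<mu> A J l \<longleftrightarrow> infinite_regular l \<and>
     (\<exists>f :: 'l \<Rightarrow> 'a \<Rightarrow> 'a.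
        (\<forall>\<alpha> \<in> Field l. f \<alpha> \<in> Pi\<^sub>E A (underS \<mu>)) \<and>
        (\<forall>\<alpha> \<beta>. \<alpha> \<noteq> \<beta> \<and> (\<alpha>, \<beta>) \<in> l \<longrightarrow> less_mod \<mu> A J (f \<alpha>) (f \<beta>)) \<and>
        (\<forall>g \<in> Pi\<^sub>E A (underS \<mu>). \<exists>\<alpha> \<in> Field l. le_mod \<mu> A J g (f \<alpha>)))"

definition PP_Gamma :: "'c rel \<Rightarrow> 'b rel \<Rightarrow> 'a rel \<Rightarrow> 'l rel set" where
  "PP_Gamma \<theta> \<sigma> \<mu> =
     {l. Card_order l \<and>
         (\<exists>A J. A \<subseteq> Reg_below \<mu> \<and> cofinal A \<mu> \<and> |A| <o \<theta> \<and>
                proper_ideal_on A J \<and> complete_ideal \<sigma> J \<and>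
                (\<forall>B. B \<subseteq> A \<and> (\<exists>b \<in> Field \<mu>. \<forall>x \<in> B. (x, b) \<in> \<mu>) \<longrightarrow> B \<in> J) \<and>
                is_tcf \<mu> A J l)}"

definition is_card_sup :: "'c rel set \<Rightarrow> 'k rel \<Rightarrow> bool" where
  "is_card_sup S \<kappa> \<longleftrightarrow> Card_order \<kappa> \<and> (\<forall>l \<in> S. l \<le>o \<kappa>) \<and>
     (\<forall>\<rho> :: 'k rel. Card_order \<rho> \<and> (\<forall>l \<in> S. l \<le>o \<rho>) \<longrightarrow> \<kappa> \<le>o \<rho>)"

text \<open>
  A quantifier over cardinals has to range over relations on some type. Every member of
  \<open>PP_Gamma \<theta> \<sigma> \<mu>\<close> has a copy on the type \<open>'a \<Rightarrow> 'a\<close> of functions between ordinals below \<open>\<mu>\<close>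
  (lemmas \<open>is_tcf_le_functions\<close> and \<open>is_tcf_ordIso\<close>), so the supremum below is over all of them.
\<close>

definition is_pp_Gamma :: "'c rel \<Rightarrow> 'b rel \<Rightarrow> 'a rel \<Rightarrow> 'k rel \<Rightarrow> bool" where
  "is_pp_Gamma \<theta> \<sigma> \<mu> \<kappa> \<longleftrightarrow> is_card_sup (PP_Gamma \<theta> \<sigma> \<mu> :: ('a \<Rightarrow> 'a) rel set) \<kappa>"

lemma cofinality_least:
  assumes "Cinfinite r"
  shows "\<exists>K. cofinality r = |K| \<and> K \<subseteq> Field r \<and> cofinal K r \<and>
             (\<forall>L. L \<subseteq> Field r \<and> cofinal L r \<longrightarrow> |K| \<le>o |L| )"
proof -
  define R where "R = card_of ` {K. K \<subseteq> Field r \<and> cofinal K r}"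
  have "cofinal (Field r) r"
    unfolding cofinal_def using infinite_Card_order_limit[of r] assms
    by (simp add: cinfinite_def)
  then have "R \<noteq> {}" unfolding R_def by auto
  moreover have "\<forall>c\<in>R. Card_order c" unfolding R_def by (auto simp: card_of_Card_order)
  ultimately have "\<exists>c\<in>R. \<forall>c'\<in>R. c \<le>o c'" by (rule exists_minim_Card_order)
  then obtain c where c: "c \<in> R" "\<forall>c'\<in>R. c \<le>o c'" by (elim bexE)
  from c(1) obtain K where K: "c = |K|" "K \<subseteq> Field r" "cofinal K r"
    unfolding R_def by (elim imageE) simp
  have "|K| \<le>o |L|" if "L \<subseteq> Field r \<and> cofinal L r" for L
  proof -
    have "|L| \<in> R" unfolding R_def using that by simp
    then show ?thesis using c(2) K(1) by simp
  qed
  then have "\<exists>K. c = |K| \<and> K \<subseteq> Field r \<and> cofinal K r \<and>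
               (\<forall>L. L \<subseteq> Field r \<and> cofinal L r \<longrightarrow> |K| \<le>o |L| )"
    using K by (intro exI[of _ K]) simp
  then show ?thesis unfolding cofinality_def by (rule someI)
qed

lemma is_tcf_le_functions:
  fixes \<mu> :: "'a rel" and l :: "'l rel"
  assumes "proper_ideal_on A J" and "is_tcf \<mu> A J l"
  shows "l \<le>o |UNIV :: ('a \<Rightarrow> 'a) set|"
proof -
  have l: "Card_order l"
    using assms(2) by (simp add: is_tcf_def infinite_regular_def)
  obtain f :: "'l \<Rightarrow> 'a \<Rightarrow> 'a" where
    f: "\<forall>\<alpha> \<beta>. \<alpha> \<noteq> \<beta> \<and> (\<alpha>, \<beta>) \<in> l \<longrightarrow> less_mod \<mu> A J (f \<alpha>) (f \<beta>)"
    using assms(2) unfolding is_tcf_def by (elim conjE exE)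
  have ne: "f \<alpha> \<noteq> f \<beta>" if "\<alpha> \<noteq> \<beta>" "(\<alpha>, \<beta>) \<in> l" for \<alpha> \<beta>
  proof
    assume eq: "f \<alpha> = f \<beta>"
    have "less_mod \<mu> A J (f \<alpha>) (f \<beta>)" using f that by simp
    then have "A \<in> J" by (simp add: eq less_mod_def)
    then show False using assms(1) by (simp add: proper_ideal_on_def)
  qed
  have tot: "total_on (Field l) l"
    using l by (simp add: card_order_on_def well_order_on_def linear_order_on_def)
  have "inj_on f (Field l)"
  proof (rule inj_onI, rule ccontr)
    fix \<alpha> \<beta> assume a: "\<alpha> \<in> Field l" "\<beta> \<in> Field l" "f \<alpha> = f \<beta>" "\<alpha> \<noteq> \<beta>"
    then have "(\<alpha>, \<beta>) \<in> l \<or> (\<beta>, \<alpha>) \<in> l" using tot by (simp add: total_on_def)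
    then show False using ne[of \<alpha> \<beta>] ne[of \<beta> \<alpha>] a by auto
  qed
  then have "|Field l| \<le>o |UNIV :: ('a \<Rightarrow> 'a) set|"
    by (intro card_of_ordLeqI) auto
  with ordIso_symmetric[OF card_of_Field_ordIso[OF l]] show ?thesis
    by (rule ordIso_ordLeq_trans)
qed

lemma is_tcf_ordIso:
  fixes l :: "'l rel" and l' :: "'m rel"
  assumes "is_tcf \<mu> A J l" and "l =o l'"
  shows "is_tcf \<mu> A J l'"
proof -
  have l: "Cinfinite l" "regularCard l"
    using assms(1) by (simp_all add: is_tcf_def infinite_regular_def)
  have l': "infinite_regular l'"
    unfolding infinite_regular_def
    using Cinfinite_cong[OF assms(2) l(1)] regularCard_ordIso[OF assms(2) l] by simp
  obtain f where f: "\<forall>\<alpha> \<in> Field l. f \<alpha> \<in> Pi\<^sub>E A (underS \<mu>)"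
      "\<forall>\<alpha> \<beta>. \<alpha> \<noteq> \<beta> \<and> (\<alpha>, \<beta>) \<in> l \<longrightarrow> less_mod \<mu> A J (f \<alpha>) (f \<beta>)"
      "\<forall>g \<in> Pi\<^sub>E A (underS \<mu>). \<exists>\<alpha> \<in> Field l. le_mod \<mu> A J g (f \<alpha>)"
    using assms(1) unfolding is_tcf_def by (elim conjE exE)
  obtain h where "iso l' l h"
    using ordIso_symmetric[OF assms(2)] unfolding ordIso_def by auto
  then have bij: "bij_betw h (Field l') (Field l)"
    and mono: "\<forall>a \<in> Field l'. \<forall>b \<in> Field l'. (a, b) \<in> l' \<longleftrightarrow> (h a, h b) \<in> l"
    by (simp_all add: iso_iff2)
  have img: "h ` Field l' = Field l" and inj: "inj_on h (Field l')"
    using bij by (simp_all add: bij_betw_def)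
  have 1: "\<forall>\<alpha> \<in> Field l'. (f \<circ> h) \<alpha> \<in> Pi\<^sub>E A (underS \<mu>)"
  proof
    fix \<alpha> assume "\<alpha> \<in> Field l'"
    then have "h \<alpha> \<in> Field l" using img by blast
    then show "(f \<circ> h) \<alpha> \<in> Pi\<^sub>E A (underS \<mu>)" using f(1) by simp
  qed
  have 2: "\<forall>\<alpha> \<beta>. \<alpha> \<noteq> \<beta> \<and> (\<alpha>, \<beta>) \<in> l' \<longrightarrow> less_mod \<mu> A J ((f \<circ> h) \<alpha>) ((f \<circ> h) \<beta>)"
  proof (intro allI impI)
    fix \<alpha> \<beta> assume a: "\<alpha> \<noteq> \<beta> \<and> (\<alpha>, \<beta>) \<in> l'"
    then have F: "\<alpha> \<in> Field l'" "\<beta> \<in> Field l'" by (auto simp: Field_def)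
    have "h \<alpha> \<noteq> h \<beta>" using inj_on_eq_iff[OF inj F] a by simp
    moreover have "(h \<alpha>, h \<beta>) \<in> l" using mono F a by simp
    ultimately show "less_mod \<mu> A J ((f \<circ> h) \<alpha>) ((f \<circ> h) \<beta>)" using f(2) by simp
  qed
  have 3: "\<forall>g \<in> Pi\<^sub>E A (underS \<mu>). \<exists>\<alpha> \<in> Field l'. le_mod \<mu> A J g ((f \<circ> h) \<alpha>)"
  proof
    fix g assume "g \<in> Pi\<^sub>E A (underS \<mu>)"
    then obtain \<alpha> where \<alpha>: "\<alpha> \<in> Field l" "le_mod \<mu> A J g (f \<alpha>)" using f(3) by auto
    then obtain \<beta> where "\<beta> \<in> Field l'" "\<alpha> = h \<beta>" using img by blast
    then show "\<exists>\<alpha> \<in> Field l'. le_mod \<mu> A J g ((f \<circ> h) \<alpha>)" using \<alpha> by auto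
  qed
  show ?thesis unfolding is_tcf_def using l' 1 2 3 by (intro conjI exI[of _ "f \<circ> h"])
qed

end

theory Submission
  imports Defs
begin

text \<open>
  Say that a family \<open>F\<close> of functions covers \<open>A\<close> if every \<open>g \<in> \<Prod>A\<close> is dominated, off a bounded
  subset of \<open>A\<close>, by fewer than \<open>\<sigma>\<close> members of \<open>F\<close> together, each doing its share of the
  coordinates; \<open>A\<close> is thin if a family of size less than \<open>\<kappa>\<close> covers it. The thin subsets form a
  \<open>\<sigma>\<close>-complete ideal containing the bounded sets.

  If some progressive \<open>A\<close> (\<open>|A| < a\<close> for all \<open>a \<in> A\<close>) is not thin, take a non-thin
  subset \<open>B\<close> of it whose least covering family \<open>L\<close> is as small as possible. Modulo the thin ideal every family smaller than \<open>L\<close> is bounded, and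
  \<open>L\<close> is not; a sequence of length \<open>|L|\<close> that is increasing and dominates \<open>L\<close> is then cofinal, so
  \<open>|L| \<ge> \<kappa>\<close> is a true cofinality and, by the choice of \<open>\<kappa>\<close> as a supremum, \<open>|L| = \<kappa>\<close>.

  If all progressive sets are thin, fewer than \<open>\<kappa>\<close> sets of size below \<open>\<mu>\<close> suffice to cover each
  \<open>X \<subseteq> \<mu>\<close> of size below \<open>\<mu>\<close> by fewer than \<open>\<sigma>\<close> of them: starting from a cofinal subset of \<open>\<mu>\<close>,
  approximations \<open>\<beta> > x\<close> are lowered along a ladder in \<open>\<beta>\<close>, the rungs being guessed by the covering
  family of the set of cofinalities that occur. Uncountability of \<open>\<sigma>\<close> absorbs the \<open>\<omega>\<close> many rounds.
  But a true cofinality in \<open>PP\<close> larger than the number of these sets yields a set \<open>X\<close> that is not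
  so covered.
\<close>

subsection \<open>Regular cardinals and ordinals below \<open>\<mu>\<close>\<close>

text \<open>Regularity says that \<open>S\<close> is not \<open>cofinal\<close>, which only yields a
  point that no element of \<open>S\<close> exceeds. Moving up once more, by the limit property of
  an infinite cardinal, makes the bound strict.\<close>

lemma regular_strict_bound:
  assumes "Cinfinite r" "regularCard r" "S \<subseteq> Field r" "|S| <o r"
  shows "\<exists>b \<in> Field r. \<forall>x \<in> S. x \<in> underS r b"
proof -
  have wo: "wo_rel r"
    using assms(1) by (simp add: wo_rel_def card_order_on_def)
  have "\<not> cofinal S r"
    using assms(2-4) not_ordLess_ordIso unfolding regularCard_def by blast
  then obtain a where a: "a \<in> Field r" "\<forall>x\<in>S. \<not> (a \<noteq> x \<and> (a, x) \<in> r)"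
    unfolding cofinal_def by blast
  obtain b where b: "b \<in> Field r" "a \<noteq> b" "(a, b) \<in> r"
    using infinite_Card_order_limit[of r a] assms(1) a(1) by (auto simp: cinfinite_def)
  have "x \<in> underS r b" if "x \<in> S" for x
  proof -
    have "(x, a) \<in> r"
      using wo_rel.TOTALS[OF wo] a assms(3) that by (metis subsetD)
    then have "(x, b) \<in> r"
      using b(3) wo_rel.TRANS[OF wo] by (meson transD)
    moreover have "x \<noteq> b"
      using \<open>(x, a) \<in> r\<close> b(2,3) wo_rel.ANTISYM[OF wo] by (meson antisymD)
    ultimately show ?thesis by (simp add: underS_def)
  qed
  with b(1) show ?thesis by blast
qed

text \<open>By induction on \<open>n\<close>, fewer than \<open>r\<close> points are reachable in
  \<open>n\<close> steps; the countable union over \<open>n\<close> stays below \<open>r\<close>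
  because \<open>r\<close> is regular and uncountable. Used with \<kappa> and with \<sigma>, it
  bounds the closures from which covering families are built.\<close>

lemma card_of_reachable_less:
  assumes "Cinfinite r" "regularCard r" "natLeq <o r" "\<And>x. |N x| <o r"
  shows "|{y. (x0, y) \<in> {(x, y). y \<in> N x}\<^sup>*}| <o r"
proof -
  let ?R = "{(x, y). y \<in> N x}"
  have fin: "|X| <o r" if "finite X" for X :: "'x set"
    using finite_iff_ordLess_natLeq[of X] that assms(3) ordLess_transitive by blast
  have lev: "|(?R ^^ n) `` {x0}| <o r" for n
  proof (induction n)
    case 0
    show ?case by (rule fin) simp
  next
    case (Suc n)
    have "(?R ^^ Suc n) `` {x0} = (\<Union>x \<in> (?R ^^ n) `` {x0}. N x)" by auto
    then show ?case
      using card_of_UNION_ordLess_infinite_Field_regularCard[OF assms(2,1) Suc.IH, of N] assms(4)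
      by simp
  qed
  have eq: "{y. (x0, y) \<in> ?R\<^sup>*} = (\<Union>n. (?R ^^ n) `` {x0})"
    by (auto simp: rtrancl_power)
  have "|UNIV :: nat set| <o r"
    using card_of_nat assms(3) ordIso_ordLess_trans by blast
  then show ?thesis
    unfolding eq
    by (rule card_of_UNION_ordLess_infinite_Field_regularCard[OF assms(2,1)]) (simp add: lev)
qed

locale pp_setting =
  fixes \<sigma> :: "'b rel" and \<mu> :: "'a rel"
  assumes sigma_card: "Card_order \<sigma>" and sigma_regular: "regularCard \<sigma>"
    and sigma_uncountable: "natLeq <o \<sigma>"
    and mu_singular: "singular \<mu>" and sigma_cofinality: "\<sigma> \<le>o cofinality \<mu>"
begin

abbreviation less_mu (infix "\<prec>" 50) where "x \<prec> y \<equiv> x \<in> underS \<mu> y"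
abbreviation leq_mu (infix "\<preceq>" 50) where "x \<preceq> y \<equiv> (x, y) \<in> \<mu>"

lemma sigma_Cinfinite: "Cinfinite \<sigma>"
  using sigma_card sigma_uncountable natLeq_Cinfinite cinfinite_mono ordLess_imp_ordLeq by blast

lemma mu_Cinfinite: "Cinfinite \<mu>"
  using mu_singular by (simp add: singular_def)

lemma mu_Card: "Card_order \<mu>"
  using mu_Cinfinite by simp

lemma mu_wo: "wo_rel \<mu>"
  using mu_Card by (simp add: wo_rel_def card_order_on_def)

lemma mu_Well: "Well_order \<mu>"
  using mu_wo by (simp add: wo_rel_def)

lemma card_of_Field_mu: "|Field \<mu>| =o \<mu>"
  using mu_Card by (rule card_of_Field_ordIso)

lemma less_Field: "x \<prec> y \<Longrightarrow> x \<in> Field \<mu>" "x \<prec> y \<Longrightarrow> y \<in> Field \<mu>"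
  by (auto simp: underS_def Field_def)

lemma leq_refl: "x \<in> Field \<mu> \<Longrightarrow> x \<preceq> x"
  using wo_rel.REFL[OF mu_wo] by (simp add: refl_on_def)

lemma leq_trans: "x \<preceq> y \<Longrightarrow> y \<preceq> z \<Longrightarrow> x \<preceq> z"
  using wo_rel.TRANS[OF mu_wo] by (meson transD)

lemma leq_antisym: "x \<preceq> y \<Longrightarrow> y \<preceq> x \<Longrightarrow> x = y"
  using wo_rel.ANTISYM[OF mu_wo] by (meson antisymD)

lemma less_imp_leq: "x \<prec> y \<Longrightarrow> x \<preceq> y"
  by (simp add: underS_def)

lemma leq_less_trans: "x \<preceq> y \<Longrightarrow> y \<prec> z \<Longrightarrow> x \<prec> z"
  using leq_trans leq_antisym by (auto simp: underS_def)

lemma less_leq_trans: "x \<prec> y \<Longrightarrow> y \<preceq> z \<Longrightarrow> x \<prec> z"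
  using leq_trans leq_antisym by (auto simp: underS_def)

lemma less_trans: "x \<prec> y \<Longrightarrow> y \<prec> z \<Longrightarrow> x \<prec> z"
  using leq_less_trans less_imp_leq by blast

lemma less_irrefl: "\<not> x \<prec> x"
  by (simp add: underS_def)

lemma not_less: "x \<in> Field \<mu> \<Longrightarrow> y \<in> Field \<mu> \<Longrightarrow> \<not> x \<prec> y \<longleftrightarrow> y \<preceq> x"
  using wo_rel.TOTALS[OF mu_wo] leq_refl leq_antisym by (auto simp: underS_def)

lemma less_or_eq: "x \<preceq> y \<Longrightarrow> x = y \<or> x \<prec> y"
  by (auto simp: underS_def)

lemma least_exists:
  assumes "S \<subseteq> Field \<mu>" "S \<noteq> {}"
  shows "\<exists>m \<in> S. \<forall>x \<in> S. m \<preceq> x"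
  using wo_rel.minim_in[OF mu_wo assms] wo_rel.minim_least[OF mu_wo assms(1)] by blast

lemma card_segment_mono: "a \<preceq> b \<Longrightarrow> |underS \<mu> a| \<le>o |underS \<mu> b|"
  using less_leq_trans by (blast intro: card_of_mono1)

lemma card_segment_less_mu: "a \<in> Field \<mu> \<Longrightarrow> |underS \<mu> a| <o \<mu>"
  by (rule card_of_underS[OF mu_Card])

lemma Field_segment: "Field (Restr \<mu> (underS \<mu> a)) = underS \<mu> a"
  by (rule Field_Restr_ofilter[OF mu_Well wo_rel.underS_ofilter[OF mu_wo]])

lemma card_less_segment:
  assumes "|S| <o \<mu>"
  shows "\<exists>a \<in> Field \<mu>. |S| =o Restr \<mu> (underS \<mu> a)"
  using assms ordLess_iff_ordIso_Restr[OF mu_Well card_of_Well_order] by blast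

lemma Reg_below_Field: "a \<in> Reg_below \<mu> \<Longrightarrow> a \<in> Field \<mu>"
  by (simp add: Reg_below_def)

lemma Reg_below_Card:
  assumes "a \<in> Reg_below \<mu>"
  shows "|underS \<mu> a| =o Restr \<mu> (underS \<mu> a)" "infinite (underS \<mu> a)"
    "Cinfinite (Restr \<mu> (underS \<mu> a))" "regularCard (Restr \<mu> (underS \<mu> a))"
proof -
  show C: "Cinfinite (Restr \<mu> (underS \<mu> a))" and "regularCard (Restr \<mu> (underS \<mu> a))"
    using assms by (simp_all add: Reg_below_def infinite_regular_def)
  then show "|underS \<mu> a| =o Restr \<mu> (underS \<mu> a)" "infinite (underS \<mu> a)"
    using card_of_Field_ordIso[of "Restr \<mu> (underS \<mu> a)"] Field_segment
    by (simp_all add: cinfinite_def)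
qed

lemma Reg_below_strict_bound:
  assumes "a \<in> Reg_below \<mu>" "S \<subseteq> underS \<mu> a" "|S| <o |underS \<mu> a|"
  shows "\<exists>b. b \<prec> a \<and> (\<forall>x \<in> S. x \<prec> b)"
proof -
  let ?r = "Restr \<mu> (underS \<mu> a)"
  have "|S| <o ?r" using assms(3) Reg_below_Card(1)[OF assms(1)] ordLess_ordIso_trans by blast
  then obtain b where "b \<in> Field ?r" "\<forall>x \<in> S. x \<in> underS ?r b"
    using regular_strict_bound[OF Reg_below_Card(3,4)[OF assms(1)], of S] assms(2) Field_segment
    by auto
  then have "b \<prec> a" "\<forall>x \<in> S. x \<prec> b"
    by (simp_all only: Field_segment) (simp add: underS_def)
  then show ?thesis by blast
qed

text \<open>Take for \<open>b\<close> the ordinal of order type \<open>|S|\<close>. A regular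
  \<open>a\<close> beyond \<open>b\<close> is a cardinal having the segment of \<open>b\<close> as a
  proper initial segment, hence is larger than \<open>|S|\<close>. The exceptional coordinates are
  therefore bounded, and negligible modulo the ideals considered below.\<close>

lemma Reg_below_above_card:
  assumes "|S| <o \<mu>"
  shows "\<exists>b \<in> Field \<mu>. \<forall>a \<in> Reg_below \<mu>. a \<preceq> b \<or> |S| <o |underS \<mu> a|"
proof -
  obtain b where b: "b \<in> Field \<mu>" "|S| =o Restr \<mu> (underS \<mu> b)"
    using card_less_segment[OF assms] by blast
  have "|S| <o |underS \<mu> a|" if a: "a \<in> Reg_below \<mu>" "\<not> a \<preceq> b" for a
  proof -
    have ba: "b \<prec> a" using a b(1) not_less Reg_below_Field by blast
    let ?r = "Restr \<mu> (underS \<mu> a)"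
    have W: "Well_order ?r" using Well_order_Restr[OF mu_Well] .
    have sub: "underS \<mu> b \<subset> underS \<mu> a"
      using ba less_trans less_irrefl by blast
    have "Restr \<mu> (underS \<mu> b) <o ?r"
      using ofilter_subset_ordLess[OF mu_Well wo_rel.underS_ofilter[OF mu_wo]
          wo_rel.underS_ofilter[OF mu_wo]] sub by blast
    then have "|S| <o ?r" using b(2) ordIso_ordLess_trans by blast
    then show ?thesis
      using Reg_below_Card(1)[OF a(1)] ordIso_symmetric ordLess_ordIso_trans by blast
  qed
  with b(1) show ?thesis by blast
qed

text \<open>A single domain for all products: values outside the set at hand do no harm.\<close>

definition Prods :: "('a \<Rightarrow> 'a) set" where
  "Prods = (\<Pi> a \<in> Reg_below \<mu>. underS \<mu> a)"

lemma Prods_less: "f \<in> Prods \<Longrightarrow> a \<in> Reg_below \<mu> \<Longrightarrow> f a \<prec> a"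
  by (auto simp: Prods_def)

lemma Prods_Field: "f \<in> Prods \<Longrightarrow> a \<in> Reg_below \<mu> \<Longrightarrow> f a \<in> Field \<mu>"
  using Prods_less less_Field(1) by blast

text \<open>At a coordinate \<open>a\<close> larger than \<open>|K|\<close>, regularity of
  \<open>a\<close> bounds the \<open>|K|\<close> values; at the other coordinates any element below
  \<open>a\<close> serves.\<close>

lemma pointwise_strict_bound:
  assumes "\<And>k a. k \<in> K \<Longrightarrow> a \<in> Reg_below \<mu> \<Longrightarrow> F k a \<prec> a"
  shows "\<exists>h \<in> Prods. \<forall>a \<in> Reg_below \<mu>. |K| <o |underS \<mu> a| \<longrightarrow> (\<forall>k \<in> K. F k a \<prec> h a)"
proof -
  have "\<exists>b. b \<prec> a \<and> ( |K| <o |underS \<mu> a| \<longrightarrow> (\<forall>k \<in> K. F k a \<prec> b))"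
    if a: "a \<in> Reg_below \<mu>" for a
  proof (cases "|K| <o |underS \<mu> a|")
    case True
    have "|(\<lambda>k. F k a) ` K| <o |underS \<mu> a|"
      using card_of_image True ordLeq_ordLess_trans by blast
    moreover have "(\<lambda>k. F k a) ` K \<subseteq> underS \<mu> a"
      by (rule image_subsetI) (rule assms[OF _ a])
    ultimately obtain b where "b \<prec> a" "\<forall>x \<in> (\<lambda>k. F k a) ` K. x \<prec> b"
      using Reg_below_strict_bound[OF a, of "(\<lambda>k. F k a) ` K"] by auto
    then show ?thesis by auto
  next
    case False
    have "underS \<mu> a \<noteq> {}" using Reg_below_Card(2)[OF a] by auto
    then show ?thesis using False by blast
  qed
  then have "\<exists>h. \<forall>a \<in> Reg_below \<mu>. h a \<prec> a \<and>
      ( |K| <o |underS \<mu> a| \<longrightarrow> (\<forall>k \<in> K. F k a \<prec> h a))"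
    by (intro bchoice ballI)
  then obtain h where h: "\<forall>a \<in> Reg_below \<mu>. h a \<prec> a \<and>
      ( |K| <o |underS \<mu> a| \<longrightarrow> (\<forall>k \<in> K. F k a \<prec> h a))" by (rule exE)
  then have "h \<in> Prods" by (simp add: Prods_def)
  with h show ?thesis by (intro bexI[of _ h]) simp_all
qed

text \<open>\<open>K\<close> is a cofinal set of least size. It is smaller than \<mu> by singularity
  and at least as large as \<sigma> by the assumption on the cofinality, so fewer than \<sigma>
  ordinals are never cofinal.\<close>

lemma small_cofinal_set:
  obtains K where "K \<subseteq> Field \<mu>" "cofinal K \<mu>" "|K| <o \<mu>" "infinite K" "\<sigma> \<le>o |K|"
    "\<And>S. S \<subseteq> Field \<mu> \<Longrightarrow> |S| <o \<sigma> \<Longrightarrow> \<exists>b \<in> Field \<mu>. \<forall>x \<in> S. x \<preceq> b"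
proof -
  obtain K where K: "cofinality \<mu> = |K|" "K \<subseteq> Field \<mu>" "cofinal K \<mu>"
      "\<And>L. L \<subseteq> Field \<mu> \<and> cofinal L \<mu> \<Longrightarrow> |K| \<le>o |L|"
    using cofinality_least[OF mu_Cinfinite] by blast
  obtain L where L: "L \<subseteq> Field \<mu>" "cofinal L \<mu>" "\<not> |L| =o \<mu>"
    using mu_singular unfolding singular_def regularCard_def by blast
  have "|L| \<le>o \<mu>" using card_of_mono1[OF L(1)] card_of_Field_mu ordLeq_ordIso_trans by blast
  then have "|L| <o \<mu>" using L(3) ordLeq_iff_ordLess_or_ordIso by blast
  then have Kless: "|K| <o \<mu>" using K(4)[of L] L ordLeq_ordLess_trans by blast
  have sK: "\<sigma> \<le>o |K|" using sigma_cofinality K(1) by simp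
  have "natLeq \<le>o |K|"
    using sigma_uncountable sK ordLess_ordLeq_trans ordLess_imp_ordLeq by blast
  then have inf: "infinite K" using infinite_iff_natLeq_ordLeq by blast
  have "\<exists>b \<in> Field \<mu>. \<forall>x \<in> S. x \<preceq> b" if S: "S \<subseteq> Field \<mu>" "|S| <o \<sigma>" for S
  proof -
    have "|S| <o |K|" using S(2) sK ordLess_ordLeq_trans by blast
    then have "\<not> cofinal S \<mu>" using K(4)[of S] S(1) not_ordLeq_ordLess by blast
    then obtain b where b: "b \<in> Field \<mu>" "\<forall>x \<in> S. \<not> b \<prec> x"
      unfolding cofinal_def underS_def by blast
    then show ?thesis using not_less S(1) by blast
  qed
  then show thesis by (rule that[OF K(2,3) Kless inf sK])
qed

lemma sigma_small_bounded:
  assumes "S \<subseteq> Field \<mu>" "|S| <o \<sigma>"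
  shows "\<exists>b \<in> Field \<mu>. \<forall>x \<in> S. x \<preceq> b"
proof (rule small_cofinal_set)
  fix K
  assume "\<And>S. S \<subseteq> Field \<mu> \<Longrightarrow> |S| <o \<sigma> \<Longrightarrow> \<exists>b \<in> Field \<mu>. \<forall>x \<in> S. x \<preceq> b"
  then show ?thesis using assms .
qed

lemma sigma_less_mu: "\<sigma> <o \<mu>"
proof (rule small_cofinal_set)
  fix K
  assume "\<sigma> \<le>o |K|" "|K| <o \<mu>"
  then show ?thesis by (rule ordLeq_ordLess_trans)
qed

end

subsection \<open>Bounds modulo a \<open>\<sigma>\<close>-complete ideal\<close>

lemma finite_card_less_infinite: "finite X \<Longrightarrow> infinite Y \<Longrightarrow> |X| <o |Y|"
  using finite_iff_ordLess_natLeq[of X] infinite_iff_natLeq_ordLeq[of Y]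
  by (auto intro: ordLess_ordLeq_trans)

context pp_setting
begin

lemma less_mod_iff: "less_mod \<mu> A J f g \<longleftrightarrow> {a \<in> A. \<not> f a \<prec> g a} \<in> J"
  by (simp add: less_mod_def underS_def)

text \<open>The conditions that \<open>PP_Gamma\<close> puts on an ideal. Cofinality of
  \<open>A\<close> follows from properness, since a bounded \<open>A\<close> would belong to
  \<open>J\<close>.\<close>

definition good_ideal :: "'a set \<Rightarrow> 'a set set \<Rightarrow> bool" where
  "good_ideal A J \<longleftrightarrow> A \<subseteq> Reg_below \<mu> \<and> proper_ideal_on A J \<and> complete_ideal \<sigma> J \<and>
     (\<forall>B. B \<subseteq> A \<and> (\<exists>b \<in> Field \<mu>. \<forall>x \<in> B. x \<preceq> b) \<longrightarrow> B \<in> J)"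

lemma good_ideal_subset: "good_ideal A J \<Longrightarrow> X \<in> J \<Longrightarrow> Y \<subseteq> X \<Longrightarrow> Y \<in> J"
  by (simp add: good_ideal_def proper_ideal_on_def)

lemma good_ideal_Un: "good_ideal A J \<Longrightarrow> X \<in> J \<Longrightarrow> Y \<in> J \<Longrightarrow> X \<union> Y \<in> J"
  by (simp add: good_ideal_def proper_ideal_on_def)

lemma good_ideal_UN:
  assumes "good_ideal A J" "|K| <o \<sigma>" "\<And>k. k \<in> K \<Longrightarrow> X k \<in> J"
  shows "(\<Union>k \<in> K. X k) \<in> J"
proof -
  have "|X ` K| <o \<sigma>" using card_of_image assms(2) ordLeq_ordLess_trans by blast
  moreover have "X ` K \<subseteq> J" using assms(3) by (rule image_subsetI)
  ultimately show ?thesis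
    using assms(1) unfolding good_ideal_def complete_ideal_def by simp
qed

lemma good_ideal_boundedI:
  assumes "good_ideal A J" "B \<subseteq> A" "b \<in> Field \<mu>" "\<forall>x \<in> B. x \<preceq> b"
  shows "B \<in> J"
proof -
  have "B \<subseteq> A \<and> (\<exists>b \<in> Field \<mu>. \<forall>x \<in> B. x \<preceq> b) \<longrightarrow> B \<in> J"
    using assms(1) unfolding good_ideal_def by (elim conjE) (erule spec)
  then show ?thesis using assms(2-4) by blast
qed

lemma good_ideal_bounded: "good_ideal A J \<Longrightarrow> b \<in> Field \<mu> \<Longrightarrow> {a \<in> A. a \<preceq> b} \<in> J"
  by (rule good_ideal_boundedI) auto

lemma good_ideal_proper: "good_ideal A J \<Longrightarrow> A \<notin> J"
  by (simp add: good_ideal_def proper_ideal_on_def)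

lemma good_ideal_Reg: "good_ideal A J \<Longrightarrow> a \<in> A \<Longrightarrow> a \<in> Reg_below \<mu>"
  by (auto simp: good_ideal_def)

lemma less_mod_trans:
  assumes "good_ideal A J" "less_mod \<mu> A J f g" "less_mod \<mu> A J g h"
  shows "less_mod \<mu> A J f h"
proof -
  have "{a \<in> A. \<not> f a \<prec> h a} \<subseteq> {a \<in> A. \<not> f a \<prec> g a} \<union> {a \<in> A. \<not> g a \<prec> h a}"
    using less_trans by auto
  moreover have "{a \<in> A. \<not> f a \<prec> g a} \<union> {a \<in> A. \<not> g a \<prec> h a} \<in> J"
    using good_ideal_Un[OF assms(1)] assms(2,3) by (simp add: less_mod_iff)
  ultimately show ?thesis
    unfolding less_mod_iff using good_ideal_subset[OF assms(1)] by blast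
qed

definition bounded_mod :: "'a set \<Rightarrow> 'a set set \<Rightarrow> ('a \<Rightarrow> 'a) set \<Rightarrow> bool" where
  "bounded_mod A J H \<longleftrightarrow> (\<exists>g \<in> Prods. \<forall>h \<in> H. less_mod \<mu> A J h g)"

text \<open>A pointwise strict bound works at every coordinate larger than \<open>|H|\<close>; since
  \<open>|H|\<close> is below \<mu>, the remaining coordinates are bounded and form a set in
  \<open>J\<close>.\<close>

lemma small_bounded_mod:
  assumes "good_ideal A J" "H \<subseteq> Prods" "|H| <o \<mu>"
  shows "bounded_mod A J H"
proof -
  have "\<exists>g \<in> Prods. \<forall>a \<in> Reg_below \<mu>. |H| <o |underS \<mu> a| \<longrightarrow> (\<forall>h \<in> H. h a \<prec> g a)"
    by (rule pointwise_strict_bound) (rule Prods_less[OF subsetD[OF assms(2)]])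
  then obtain g where g: "g \<in> Prods"
      "\<forall>a \<in> Reg_below \<mu>. |H| <o |underS \<mu> a| \<longrightarrow> (\<forall>h \<in> H. h a \<prec> g a)" by (rule bexE)
  obtain b where b: "b \<in> Field \<mu>" "\<forall>a \<in> Reg_below \<mu>. a \<preceq> b \<or> |H| <o |underS \<mu> a|"
    using Reg_below_above_card[OF assms(3)] by blast
  have "less_mod \<mu> A J h g" if "h \<in> H" for h
  proof -
    have "{a \<in> A. \<not> h a \<prec> g a} \<subseteq> {a \<in> A. a \<preceq> b}"
      using g(2) b(2) that good_ideal_Reg[OF assms(1)] by auto
    then show ?thesis
      unfolding less_mod_iff
      using good_ideal_subset[OF assms(1) good_ideal_bounded[OF assms(1) b(1)]] by blast
  qed
  then show ?thesis using g(1) unfolding bounded_mod_def by blast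
qed

text \<open>The members of \<open>G\<close> serve as indices: along the well-order
  \<open>|G|\<close>, choose \<open>f x\<close> above \<open>x\<close> and above all earlier values,
  which are fewer than \<open>|G|\<close> and hence bounded by minimality. A smaller cofinal set of
  indices would yield a bound for its values and, through them, for all of \<open>G\<close>; so
  \<open>|G|\<close> is regular.\<close>

lemma increasing_sequence:
  assumes J: "good_ideal A J" and G: "G \<subseteq> Prods" and unbounded: "\<not> bounded_mod A J G"
    and least: "\<And>H. H \<subseteq> Prods \<Longrightarrow> |H| <o |G| \<Longrightarrow> bounded_mod A J H"
  shows "\<mu> \<le>o |G|" "Cinfinite |G|" "regularCard |G|"
    "\<exists>f. \<forall>x \<in> G. f x \<in> Prods \<and> less_mod \<mu> A J x (f x) \<and>
       (\<forall>y \<in> underS |G| x. less_mod \<mu> A J (f y) (f x))"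
proof -
  show muG: "\<mu> \<le>o |G|"
    using small_bounded_mod[OF J G] unbounded not_ordLess_iff_ordLeq[OF mu_Well card_of_Well_order]
    by blast
  then show inf: "Cinfinite |G|"
    using mu_Cinfinite cinfinite_mono card_of_Card_order by blast
  then have infG: "infinite G" by (simp add: cinfinite_def Field_card_of)
  have wo: "wo_rel |G|" using card_of_Well_order by (simp add: wo_rel_def)
  \<comment> \<open>The condition is vacuous off \<open>G\<close>, so that well-founded choice can
    run over the whole type.\<close>
  define P where "P f x z \<longleftrightarrow> (x \<in> G \<longrightarrow> z \<in> Prods \<and> less_mod \<mu> A J x z \<and>
       (\<forall>y \<in> underS |G| x. less_mod \<mu> A J (f y) z))" for f x z
  have "\<exists>f. \<forall>x. P f x (f x)"
  proof (rule dependent_wf_choice[OF wo_rel.WF[OF wo]])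
    fix f g :: "('a \<Rightarrow> 'a) \<Rightarrow> 'a \<Rightarrow> 'a" and x z
    assume "\<And>y. (y, x) \<in> |G| - Id \<Longrightarrow> f y = g y"
    then show "P f x z = P g x z" unfolding P_def underS_def by auto
  next
    fix x f
    assume IH: "\<And>y. (y, x) \<in> |G| - Id \<Longrightarrow> P f y (f y)"
    show "\<exists>z. P f x z"
    proof (cases "x \<in> G")
      case True
      let ?H = "f ` underS |G| x \<union> {x}"
      have "|underS |G| x| <o |G|"
        by (rule card_of_underS[OF card_of_Card_order]) (simp add: Field_card_of True)
      then have "|f ` underS |G| x| <o |G|"
        by (rule ordLeq_ordLess_trans[OF card_of_image])
      moreover have "|{x}| <o |G|"
        by (rule finite_card_less_infinite[OF _ infG]) simp
      ultimately have lt: "|?H| <o |G|"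
        by (rule card_of_Un_ordLess_infinite[OF infG])
      have "f y \<in> Prods" if "y \<in> underS |G| x" for y
      proof -
        have "y \<in> G" using underS_Field[OF that] by (simp only: Field_card_of)
        moreover have "(y, x) \<in> |G| - Id" using that by (simp add: underS_def)
        ultimately show ?thesis using IH[of y] unfolding P_def by simp
      qed
      then have "?H \<subseteq> Prods" using subsetD[OF G True] by (simp add: image_subset_iff)
      then have "bounded_mod A J ?H" by (rule least[OF _ lt])
      then obtain z where z: "z \<in> Prods" "\<forall>h \<in> ?H. less_mod \<mu> A J h z"
        unfolding bounded_mod_def by (rule bexE)
      then have "P f x z" unfolding P_def by simp
      then show ?thesis by (rule exI[of _ z])
    qed (simp add: P_def)
  qed
  then obtain f where "\<forall>x. P f x (f x)" by (rule exE)
  then have f: "\<forall>x \<in> G. f x \<in> Prods \<and> less_mod \<mu> A J x (f x) \<and>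
       (\<forall>y \<in> underS |G| x. less_mod \<mu> A J (f y) (f x))"
    unfolding P_def by simp
  then show "\<exists>f. \<forall>x \<in> G. f x \<in> Prods \<and> less_mod \<mu> A J x (f x) \<and>
       (\<forall>y \<in> underS |G| x. less_mod \<mu> A J (f y) (f x))" by (rule exI[of _ f])
  show "regularCard |G|"
    unfolding regularCard_def
  proof (intro allI impI, rule ccontr)
    fix K assume K: "K \<subseteq> Field |G| \<and> cofinal K |G|" and "\<not> |K| =o |G|"
    have KG: "K \<subseteq> G" using K by (simp add: Field_card_of)
    have "|K| <o |G|"
      using \<open>\<not> |K| =o |G|\<close> card_of_mono1[OF KG] by (simp add: ordLeq_iff_ordLess_or_ordIso)
    then have "|f ` K| <o |G|" by (rule ordLeq_ordLess_trans[OF card_of_image])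
    moreover have "f ` K \<subseteq> Prods" using f subsetD[OF KG] by (simp add: image_subset_iff)
    ultimately have "bounded_mod A J (f ` K)" by (intro least)
    then obtain g where g: "g \<in> Prods" "\<forall>h \<in> f ` K. less_mod \<mu> A J h g"
      unfolding bounded_mod_def by (rule bexE)
    have "less_mod \<mu> A J x g" if x: "x \<in> G" for x
    proof -
      obtain k where k: "k \<in> K" "x \<in> underS |G| k"
        using K x unfolding cofinal_def underS_def Field_card_of by auto
      have "less_mod \<mu> A J x (f x)" using f x by simp
      moreover have "less_mod \<mu> A J (f x) (f k)" using f subsetD[OF KG k(1)] k(2) by simp
      moreover have "less_mod \<mu> A J (f k) g" using g(2) k(1) by simp
      ultimately show ?thesis using less_mod_trans[OF J] by metis
    qed
    then have "bounded_mod A J G" using g(1) unfolding bounded_mod_def by (intro bexI ballI)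
    then show False using unbounded by simp
  qed
qed

text \<open>
  Iterating the escape along \<open>a\<^sub>0 = min A\<close>, with the previous functions strictly below the next
  ones, all the witnesses refer to one function \<open>f \<xi>\<close>; the witnessing coordinates are then
  pairwise different, although \<open>|A| < a\<^sub>0\<close>.
\<close>

lemma no_steady_escape:
  fixes r :: "'l rel"
  assumes A: "A \<subseteq> Reg_below \<mu>" "A \<noteq> {}" "\<And>a. a \<in> A \<Longrightarrow> |A| <o |underS \<mu> a|"
    and r: "Cinfinite r" "regularCard r" "\<mu> \<le>o r"
    and escape: "\<And>g. g \<in> Prods \<Longrightarrow> \<exists>h \<in> Prods. \<exists>\<xi>0 \<in> Field r. \<forall>\<xi>. (\<xi>0, \<xi>) \<in> r \<longrightarrow>
       (\<exists>a \<in> A. g a \<preceq> f \<xi> a \<and> f \<xi> a \<preceq> h a)"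
  shows False
proof -
  obtain a0 where a0: "a0 \<in> A" "\<forall>a \<in> A. a0 \<preceq> a"
    using least_exists[of A] A(1,2) Reg_below_Field by blast
  have a0R: "a0 \<in> Reg_below \<mu>" using a0(1) A(1) by blast
  define E where "E g h \<xi>0 \<longleftrightarrow> \<xi>0 \<in> Field r \<and>
      (\<forall>\<xi>. (\<xi>0, \<xi>) \<in> r \<longrightarrow> (\<exists>a \<in> A. g a \<preceq> f \<xi> a \<and> f \<xi> a \<preceq> h a))" for g h \<xi>0
  \<comment> \<open>The function \<open>h\<close> of stage \<open>i\<close> answers a
    \<open>g\<close> lying strictly above all earlier stages on \<open>A\<close>. Hence the
    intervals from \<open>g\<close> to \<open>h\<close> of different stages are disjoint at every
    coordinate of \<open>A\<close>.\<close>
  define P where "P G i h \<longleftrightarrow> (i \<prec> a0 \<longrightarrow> h \<in> Prods \<and>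
      (\<exists>g \<in> Prods. (\<forall>j. j \<prec> i \<longrightarrow> (\<forall>a \<in> A. G j a \<prec> g a)) \<and> (\<exists>\<xi>0. E g h \<xi>0)))" for G i h
  have "\<exists>G. \<forall>i. P G i (G i)"
  proof (rule dependent_wf_choice[OF wo_rel.WF[OF mu_wo]])
    fix G G' :: "'a \<Rightarrow> 'a \<Rightarrow> 'a" and i h
    assume "\<And>j. (j, i) \<in> \<mu> - Id \<Longrightarrow> G j = G' j"
    then have "G j = G' j" if "j \<prec> i" for j using that by (simp add: underS_def)
    then show "P G i h = P G' i h" unfolding P_def by simp
  next
    fix i G
    assume IH: "\<And>j. (j, i) \<in> \<mu> - Id \<Longrightarrow> P G j (G j)"
    show "\<exists>h. P G i h"
    proof (cases "i \<prec> a0")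
      case True
      have G: "G j \<in> Prods" if "j \<prec> i" for j
      proof -
        have "(j, i) \<in> \<mu> - Id" using that by (simp add: underS_def)
        moreover have "j \<prec> a0" using that True less_trans by blast
        ultimately show ?thesis using IH[of j] unfolding P_def by blast
      qed
      have "\<exists>g \<in> Prods. \<forall>a \<in> Reg_below \<mu>. |underS \<mu> i| <o |underS \<mu> a| \<longrightarrow>
          (\<forall>j \<in> underS \<mu> i. G j a \<prec> g a)"
        by (rule pointwise_strict_bound) (rule Prods_less[OF G])
      then obtain g where g: "g \<in> Prods" "\<forall>a \<in> Reg_below \<mu>. |underS \<mu> i| <o |underS \<mu> a| \<longrightarrow>
          (\<forall>j \<in> underS \<mu> i. G j a \<prec> g a)" by (rule bexE)
      \<comment> \<open>As \<open>a0\<close> is a cardinal, \<open>i\<close> has fewer than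
        \<open>|underS \<mu> a0|\<close> predecessors, so the bound \<open>g\<close> is strict on
        all of \<open>A\<close>, whose members are at least \<open>a0\<close>.\<close>
      let ?r = "Restr \<mu> (underS \<mu> a0)"
      have "underS \<mu> i \<subseteq> underS ?r i"
        using True less_trans[of _ i a0] by (auto simp: underS_def)
      then have "|underS \<mu> i| \<le>o |underS ?r i|" by (rule card_of_mono1)
      moreover have "|underS ?r i| <o ?r"
        using card_of_underS[of ?r i] Reg_below_Card(3)[OF a0R] True Field_segment by simp
      ultimately have "|underS \<mu> i| <o |underS \<mu> a0|"
        using Reg_below_Card(1)[OF a0R] ordIso_symmetric ordLeq_ordLess_trans
          ordLess_ordIso_trans by blast
      then have "|underS \<mu> i| <o |underS \<mu> a|" if "a \<in> A" for a
        using a0(2) that card_segment_mono ordLess_ordLeq_trans by blast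
      then have "\<forall>j. j \<prec> i \<longrightarrow> (\<forall>a \<in> A. G j a \<prec> g a)" using g(2) A(1) by blast
      moreover obtain h \<xi>0 where "h \<in> Prods" "E g h \<xi>0"
        using escape[OF g(1)] unfolding E_def by blast
      ultimately show ?thesis using g(1) unfolding P_def by blast
    qed (simp add: P_def)
  qed
  then obtain G where G: "\<And>i. P G i (G i)" by blast
  have "\<forall>i \<in> underS \<mu> a0. \<exists>p. (\<forall>j. j \<prec> i \<longrightarrow> (\<forall>a \<in> A. G j a \<prec> fst p a)) \<and> E (fst p) (G i) (snd p)"
    using G unfolding P_def by fastforce
  from bchoice[OF this] obtain p where p:
    "\<And>i. i \<prec> a0 \<Longrightarrow> (\<forall>j. j \<prec> i \<longrightarrow> (\<forall>a \<in> A. G j a \<prec> fst (p i) a)) \<and> E (fst (p i)) (G i) (snd (p i))"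
    by blast
  \<comment> \<open>There are fewer thresholds than the regular \<open>r\<close>, so one index
    \<open>\<xi>\<close> lies beyond those of all stages.\<close>
  let ?X = "(\<lambda>i. snd (p i)) ` underS \<mu> a0"
  have "|underS \<mu> a0| <o r"
    using card_segment_less_mu[OF Reg_below_Field[OF a0R]] r(3) ordLess_ordLeq_trans by blast
  then have "|?X| <o r" using card_of_image ordLeq_ordLess_trans by blast
  moreover have "?X \<subseteq> Field r" using p unfolding E_def by blast
  ultimately obtain \<xi> where \<xi>: "\<forall>x \<in> ?X. x \<in> underS r \<xi>"
    using regular_strict_bound[OF r(1,2)] by blast
  have "\<forall>i \<in> underS \<mu> a0. \<exists>a. a \<in> A \<and> fst (p i) a \<preceq> f \<xi> a \<and> f \<xi> a \<preceq> G i a"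
  proof
    fix i assume i: "i \<prec> a0"
    then have "(snd (p i), \<xi>) \<in> r" using \<xi> by (simp add: underS_def)
    then show "\<exists>a. a \<in> A \<and> fst (p i) a \<preceq> f \<xi> a \<and> f \<xi> a \<preceq> G i a"
      using p[OF i] unfolding E_def by blast
  qed
  from bchoice[OF this] obtain c where c:
    "\<And>i. i \<prec> a0 \<Longrightarrow> c i \<in> A \<and> fst (p i) (c i) \<preceq> f \<xi> (c i) \<and> f \<xi> (c i) \<preceq> G i (c i)"
    by blast
  \<comment> \<open>At a shared coordinate \<open>f \<xi>\<close> would lie in the intervals of two
    stages, which are disjoint.\<close>
  have ne: "c i \<noteq> c j" if "j \<prec> i" "i \<prec> a0" for i j
  proof
    assume eq: "c i = c j"
    have j: "j \<prec> a0" using that less_trans by blast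
    have "f \<xi> (c i) \<preceq> G j (c i)" "c i \<in> A" using c[OF j] eq by auto
    moreover have "G j (c i) \<prec> fst (p i) (c i)" using p[OF that(2)] that(1) \<open>c i \<in> A\<close> by blast
    moreover have "fst (p i) (c i) \<preceq> f \<xi> (c i)" using c[OF that(2)] by blast
    ultimately show False
      using leq_less_trans less_leq_trans less_irrefl by blast
  qed
  have "inj_on c (underS \<mu> a0)"
  proof (rule inj_onI, rule ccontr)
    fix i j assume ij: "i \<prec> a0" "j \<prec> a0" "c i = c j" "i \<noteq> j"
    then have "i \<prec> j \<or> j \<prec> i"
      using not_less[of i j] less_or_eq[of j i] less_Field(1) by blast
    then show False using ne ij by metis
  qed
  then have "|underS \<mu> a0| \<le>o |A|" using c by (intro card_of_ordLeqI) auto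
  then show False using A(3)[OF a0(1)] not_ordLess_ordLeq by blast
qed

end

subsection \<open>The thin ideal\<close>

text \<open>Regularity is available for \<kappa>, not for \<open>|Y|\<close>. If \<open>|X|\<close>
  is below \<kappa>, regularity bounds the union; otherwise \<open>X\<close> is infinite and absorbs
  sets of size below \<kappa>.\<close>

lemma card_of_UNION_less_above_regular:
  assumes \<kappa>: "Cinfinite \<kappa>" "regularCard \<kappa>" and "\<kappa> \<le>o |Y|" "|X| <o |Y|"
    and F: "\<And>x. x \<in> X \<Longrightarrow> |F x| <o \<kappa>"
  shows "|\<Union>x \<in> X. F x| <o |Y|"
proof (cases "|X| <o \<kappa>")
  case True
  then have "|\<Union>x \<in> X. F x| <o \<kappa>"
    using card_of_UNION_ordLess_infinite_Field_regularCard[OF \<kappa>(2,1)] F by blast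
  then show ?thesis using assms(3) ordLess_ordLeq_trans by blast
next
  case False
  have "Well_order \<kappa>" using \<kappa>(1) by (simp add: card_order_on_def)
  then have le: "\<kappa> \<le>o |X|"
    using False not_ordLess_iff_ordLeq[OF _ card_of_Well_order] by blast
  then have "infinite X"
    using \<kappa>(1) cinfinite_mono by (fastforce simp: cinfinite_def Field_card_of)
  moreover have "\<forall>x \<in> X. |F x| \<le>o |X|"
    using F le ordLess_ordLeq_trans ordLess_imp_ordLeq by blast
  ultimately have "|\<Union>x \<in> X. F x| \<le>o |X|"
    by (intro card_of_UNION_ordLeq_infinite) (simp_all add: card_of_Well_order ordLeq_reflexive)
  then show ?thesis using assms(4) ordLeq_ordLess_trans by blast
qed

context pp_setting
begin

definition covered :: "('a \<Rightarrow> 'a) set \<Rightarrow> 'a set \<Rightarrow> ('a \<Rightarrow> 'a) \<Rightarrow> bool" where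
  "covered F C g \<longleftrightarrow> (\<exists>H. H \<subseteq> F \<and> |H| <o \<sigma> \<and>
     (\<exists>\<nu> \<in> Field \<mu>. \<forall>a \<in> C. a \<preceq> \<nu> \<or> (\<exists>h \<in> H. g a \<preceq> h a)))"

definition covers :: "('a \<Rightarrow> 'a) set \<Rightarrow> 'a set \<Rightarrow> bool" where
  "covers F C \<longleftrightarrow> F \<subseteq> Prods \<and> (\<forall>g \<in> Prods. covered F C g)"

lemma coveredI:
  assumes "H \<subseteq> F" "|H| <o \<sigma>" "\<nu> \<in> Field \<mu>" "\<And>a. a \<in> C \<Longrightarrow> a \<preceq> \<nu> \<or> (\<exists>h \<in> H. g a \<preceq> h a)"
  shows "covered F C g"
  unfolding covered_def using assms by (intro exI[of _ H] conjI bexI[of _ \<nu>] ballI)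

lemma coveredE:
  assumes "covered F C g"
  obtains H \<nu> where "H \<subseteq> F" "|H| <o \<sigma>" "\<nu> \<in> Field \<mu>"
    "\<forall>a \<in> C. a \<preceq> \<nu> \<or> (\<exists>h \<in> H. g a \<preceq> h a)"
  using assms unfolding covered_def by (elim exE conjE bexE) simp

lemma Field_mu_nonempty: "Field \<mu> \<noteq> {}"
  using mu_Cinfinite by (auto simp: cinfinite_def)

lemma finite_less_sigma: "finite X \<Longrightarrow> |X| <o \<sigma>"
  using finite_iff_ordLess_natLeq[of X] sigma_uncountable by (auto intro: ordLess_transitive)

lemma covers_Prods: "C \<subseteq> Reg_below \<mu> \<Longrightarrow> covers Prods C"
  unfolding covers_def
proof (intro conjI ballI subset_refl)
  fix g assume C: "C \<subseteq> Reg_below \<mu>" and g: "g \<in> Prods"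
  obtain \<nu> where "\<nu> \<in> Field \<mu>" using Field_mu_nonempty by auto
  then show "covered Prods C g"
  proof (rule coveredI[of "{g}", rotated 2])
    show "{g} \<subseteq> Prods" using g by simp
    show "|{g}| <o \<sigma>" by (rule finite_less_sigma) simp
    show "a \<preceq> \<nu> \<or> (\<exists>h \<in> {g}. g a \<preceq> h a)" if "a \<in> C" for a
      using leq_refl Prods_Field[OF g] subsetD[OF C that] by simp
  qed
qed

lemma covers_subset: "covers F X \<Longrightarrow> Y \<subseteq> X \<Longrightarrow> covers F Y"
  unfolding covers_def covered_def by (meson subsetD)

lemma covers_bounded:
  assumes "b \<in> Field \<mu>" "\<forall>x \<in> C. x \<preceq> b"
  shows "covers {} C"
  unfolding covers_def using assms by (auto intro!: coveredI[of "{}" "{}" b] finite_less_sigma)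

end

locale pp_target = pp_setting \<sigma> \<mu> for \<sigma> :: "'b rel" and \<mu> :: "'a rel" +
  fixes \<kappa> :: "'k rel"
  assumes kappa_Cinfinite: "Cinfinite \<kappa>" and kappa_regular: "regularCard \<kappa>"
    and mu_less_kappa: "\<mu> <o \<kappa>"
begin

definition thin :: "'a set \<Rightarrow> bool" where
  "thin C \<longleftrightarrow> (\<exists>F. |F| <o \<kappa> \<and> covers F C)"

definition thin_ideal :: "'a set \<Rightarrow> 'a set set" where
  "thin_ideal A = {C. C \<subseteq> A \<and> thin C}"

lemma thin_subset: "thin X \<Longrightarrow> Y \<subseteq> X \<Longrightarrow> thin Y"
  unfolding thin_def using covers_subset by (elim exE conjE) (intro exI conjI)

lemma empty_less_kappa: "|{}| <o \<kappa>"
proof -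
  have "|{}| <o \<sigma>" by (rule finite_less_sigma) simp
  then show ?thesis using sigma_less_mu mu_less_kappa by (blast intro: ordLess_transitive)
qed

lemma thin_bounded: "b \<in> Field \<mu> \<Longrightarrow> \<forall>x \<in> C. x \<preceq> b \<Longrightarrow> thin C"
  unfolding thin_def by (rule exI[of _ "{}"]) (simp add: covers_bounded empty_less_kappa)

text \<open>Choose a covering family for each member of \<open>S\<close>. Regularity of \<kappa>
  keeps their union below \<kappa>; for a given \<open>g\<close>, regularity of \<sigma> keeps the
  union of the subfamilies used below \<sigma>, and the cutoffs have a common bound because \<sigma>
  is at most the cofinality of \<mu>.\<close>

lemma thin_Union:
  assumes thin: "\<And>C. C \<in> S \<Longrightarrow> thin C" and S: "|S| <o \<sigma>"
  shows "thin (\<Union>S)"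
proof -
  have "\<forall>C \<in> S. \<exists>F. |F| <o \<kappa> \<and> covers F C" using thin by (simp add: thin_def)
  from bchoice[OF this] obtain F where F: "\<And>C. C \<in> S \<Longrightarrow> |F C| <o \<kappa>" "\<And>C. C \<in> S \<Longrightarrow> covers (F C) C"
    by auto
  let ?F = "\<Union>C \<in> S. F C"
  have "|S| <o \<kappa>" using S sigma_less_mu mu_less_kappa by (blast intro: ordLess_transitive)
  then have "|?F| <o \<kappa>"
    using F(1)
    by (intro card_of_UNION_ordLess_infinite_Field_regularCard[OF kappa_regular kappa_Cinfinite])
      auto
  moreover have "covers ?F (\<Union>S)"
    unfolding covers_def
  proof (intro conjI ballI)
    show "?F \<subseteq> Prods" using F(2) by (auto simp: covers_def)
  next
    fix g assume g: "g \<in> Prods"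
    define Q where "Q C p \<longleftrightarrow> fst p \<subseteq> F C \<and> |fst p| <o \<sigma> \<and> snd p \<in> Field \<mu> \<and>
        (\<forall>a \<in> C. a \<preceq> snd p \<or> (\<exists>h \<in> fst p. g a \<preceq> h a))" for C p
    have "\<forall>C \<in> S. \<exists>p. Q C p"
    proof
      fix C assume "C \<in> S"
      then have "covered (F C) C g" using F(2) g by (simp add: covers_def)
      then obtain H \<nu> where "H \<subseteq> F C" "|H| <o \<sigma>" "\<nu> \<in> Field \<mu>"
          "\<forall>a \<in> C. a \<preceq> \<nu> \<or> (\<exists>h \<in> H. g a \<preceq> h a)" by (rule coveredE)
      then have "Q C (H, \<nu>)" by (simp add: Q_def)
      then show "\<exists>p. Q C p" by (rule exI[of _ "(H, \<nu>)"])
    qed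
    from bchoice[OF this] obtain p where p: "\<And>C. C \<in> S \<Longrightarrow> Q C (p C)" by auto
    let ?N = "(\<lambda>C. snd (p C)) ` S"
    have "|?N| <o \<sigma>" using S by (rule ordLeq_ordLess_trans[OF card_of_image])
    moreover have "?N \<subseteq> Field \<mu>" using p by (auto simp: Q_def)
    ultimately obtain \<nu> where \<nu>: "\<nu> \<in> Field \<mu>" "\<forall>x \<in> ?N. x \<preceq> \<nu>"
      using sigma_small_bounded[of ?N] by auto
    show "covered ?F (\<Union>S) g"
    proof (rule coveredI[OF _ _ \<nu>(1)])
      show "(\<Union>C \<in> S. fst (p C)) \<subseteq> ?F" using p unfolding Q_def by fast
      show "|\<Union>C \<in> S. fst (p C)| <o \<sigma>"
        using p S
        by (intro card_of_UNION_ordLess_infinite_Field_regularCard[OF sigma_regular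
              sigma_Cinfinite]) (auto simp: Q_def)
      fix a assume "a \<in> \<Union>S"
      then obtain C where C: "C \<in> S" "a \<in> C" by auto
      then have "a \<preceq> snd (p C) \<or> (\<exists>h \<in> fst (p C). g a \<preceq> h a)"
        using p[OF C(1)] by (simp add: Q_def)
      then show "a \<preceq> \<nu> \<or> (\<exists>h \<in> \<Union>C \<in> S. fst (p C). g a \<preceq> h a)"
      proof
        assume "a \<preceq> snd (p C)"
        then show ?thesis using \<nu>(2) C(1) leq_trans by auto
      qed (use C(1) in auto)
    qed
  qed
  ultimately show ?thesis unfolding thin_def by (intro exI[of _ ?F] conjI)
qed

lemma thin_ideal_good:
  assumes "A \<subseteq> Reg_below \<mu>" "\<not> thin A"
  shows "good_ideal A (thin_ideal A)"
proof -
  have U: "\<Union>S \<in> thin_ideal A" if S: "S \<subseteq> thin_ideal A" "|S| <o \<sigma>" for S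
  proof -
    have "thin (\<Union>S)" using S by (intro thin_Union) (auto simp: thin_ideal_def)
    then show ?thesis using S(1) by (auto simp: thin_ideal_def)
  qed
  have Un: "X \<union> Y \<in> thin_ideal A" if "X \<in> thin_ideal A" "Y \<in> thin_ideal A" for X Y
    using U[of "{X, Y}"] finite_less_sigma[of "{X, Y}"] that by simp
  have "thin {}"
    using thin_bounded[of _ "{}"] Field_mu_nonempty by auto
  then have empty: "{} \<in> thin_ideal A" by (simp add: thin_ideal_def)
  have down: "Y \<in> thin_ideal A" if "X \<in> thin_ideal A" "Y \<subseteq> X" for X Y
    using that thin_subset[of X Y] by (auto simp: thin_ideal_def)
  have bdd: "B \<in> thin_ideal A" if "B \<subseteq> A \<and> (\<exists>b \<in> Field \<mu>. \<forall>x \<in> B. x \<preceq> b)" for B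
    using that thin_bounded[of _ B] by (auto simp: thin_ideal_def)
  have "thin_ideal A \<subseteq> Pow A" "A \<notin> thin_ideal A"
    using assms(2) by (auto simp: thin_ideal_def)
  with empty have "proper_ideal_on A (thin_ideal A)"
    unfolding proper_ideal_on_def
    by (intro conjI ballI allI impI) (assumption | rule Un, assumption+ | rule down, assumption+)+
  moreover have "complete_ideal \<sigma> (thin_ideal A)"
    unfolding complete_ideal_def using U by simp
  ultimately show ?thesis
    unfolding good_ideal_def using assms(1)
    by (intro conjI allI impI) (assumption | rule bdd, assumption)+
qed

text \<open>An unbounded \<open>G\<close> of least size gives an increasing sequence
  \<open>f\<close> of regular length below \<open>|L|\<close>. Its values, together with covers of
  the thin sets where it drops below an earlier value, are too few to cover a non-thin set, so some
  \<open>h\<close> is left uncovered. This produces the escape that \<open>no_steady_escape\<close>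
  excludes.\<close>

lemma thin_ideal_directed:
  assumes A: "A \<subseteq> Reg_below \<mu>" "\<And>a. a \<in> A \<Longrightarrow> |A| <o |underS \<mu> a|" "\<not> thin A"
    and L: "\<kappa> \<le>o |L|" "\<And>C F. C \<subseteq> A \<Longrightarrow> \<not> thin C \<Longrightarrow> covers F C \<Longrightarrow> |L| \<le>o |F|"
    and H: "H \<subseteq> Prods" "|H| <o |L|"
  shows "bounded_mod A (thin_ideal A) H"
proof (rule ccontr)
  let ?J = "thin_ideal A"
  have J: "good_ideal A ?J" by (rule thin_ideal_good[OF A(1,3)])
  assume nb: "\<not> bounded_mod A ?J H"
  define R where "R = card_of ` {G. G \<subseteq> Prods \<and> \<not> bounded_mod A ?J G}"
  have HR: "|H| \<in> R" using H(1) nb by (simp add: R_def)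
  then have "R \<noteq> {}" by auto
  moreover have "\<forall>c\<in>R. Card_order c" unfolding R_def by (auto simp: card_of_Card_order)
  ultimately have "\<exists>c\<in>R. \<forall>c'\<in>R. c \<le>o c'" by (rule exists_minim_Card_order)
  then obtain c where c: "c \<in> R" "\<forall>c'\<in>R. c \<le>o c'" by (elim bexE)
  from c(1) obtain G where G: "c = |G|" "G \<subseteq> Prods" "\<not> bounded_mod A ?J G"
    unfolding R_def by (elim imageE) simp
  have "|G| \<le>o |H|" using c(2) HR G(1) by simp
  then have GL: "|G| <o |L|" using H(2) by (rule ordLeq_ordLess_trans)
  have least: "bounded_mod A ?J H'" if H': "H' \<subseteq> Prods" "|H'| <o |G|" for H'
  proof (rule ccontr)
    assume "\<not> bounded_mod A ?J H'"
    then have "|H'| \<in> R" using H'(1) by (simp add: R_def)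
    then have "|G| \<le>o |H'|" using c(2) G(1) by simp
    then show False using H'(2) not_ordLess_ordLeq by blast
  qed
  note seq = increasing_sequence[OF J G(2,3) least]
  from seq(4) obtain f where f: "\<forall>x \<in> G. f x \<in> Prods \<and> less_mod \<mu> A ?J x (f x) \<and>
       (\<forall>y \<in> underS |G| x. less_mod \<mu> A ?J (f y) (f x))" by (rule exE)
  have "A \<noteq> {}" using A(3) J by (auto simp: good_ideal_def proper_ideal_on_def)
  show False
  proof (rule no_steady_escape[OF A(1) \<open>A \<noteq> {}\<close> A(2) seq(2,3,1)])
    fix g assume g: "g \<in> Prods"
    have "\<exists>x \<in> G. \<not> less_mod \<mu> A ?J (f x) g"
    proof (rule ccontr)
      assume "\<not> ?thesis"
      then have "less_mod \<mu> A ?J x g" if "x \<in> G" for x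
        using f less_mod_trans[OF J, of x "f x" g] that by simp
      then have "bounded_mod A ?J G" using g unfolding bounded_mod_def by (intro bexI[of _ g] ballI)
      then show False using G(3) by simp
    qed
    then obtain x0 where x0: "x0 \<in> G" "\<not> less_mod \<mu> A ?J (f x0) g" by (rule bexE)
    \<comment> \<open>On the non-thin set \<open>D\<close> the function \<open>f x0\<close> is at
      least \<open>g\<close>; for later \<open>x\<close>, \<open>f x\<close> remains so except on
      the thin set \<open>Z x\<close> defined next.\<close>
    define D where "D = {a \<in> A. \<not> f x0 a \<prec> g a}"
    have D: "D \<subseteq> A" "\<not> thin D" using x0(2) by (auto simp: less_mod_iff D_def thin_ideal_def)
    define Z where "Z x = {a \<in> A. f x a \<prec> f x0 a}" for x
    have thinZ: "thin (Z x)" if "(x0, x) \<in> |G|" for x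
    proof (cases "x = x0")
      case True
      then have "Z x = {}" by (simp add: Z_def less_irrefl)
      then show ?thesis using J by (simp add: good_ideal_def proper_ideal_on_def thin_ideal_def)
    next
      case False
      then have "x0 \<in> underS |G| x" using that by (simp add: underS_def)
      moreover have "x \<in> G" using FieldI2[OF that] by (simp add: Field_card_of)
      ultimately have "less_mod \<mu> A ?J (f x0) (f x)" using f by simp
      then have "thin {a \<in> A. \<not> f x0 a \<prec> f x a}" by (simp add: less_mod_iff thin_ideal_def)
      then show ?thesis
        by (rule thin_subset) (auto simp: Z_def dest: less_trans simp: less_irrefl)
    qed
    have "\<forall>x. \<exists>F. |F| <o \<kappa> \<and> F \<subseteq> Prods \<and> ((x0, x) \<in> |G| \<longrightarrow> covers F (Z x))"
    proof
      fix x
      show "\<exists>F. |F| <o \<kappa> \<and> F \<subseteq> Prods \<and> ((x0, x) \<in> |G| \<longrightarrow> covers F (Z x))"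
      proof (cases "(x0, x) \<in> |G|")
        case True
        then obtain F where "|F| <o \<kappa>" "covers F (Z x)"
          using thinZ unfolding thin_def by auto
        then show ?thesis by (intro exI[of _ F]) (simp add: covers_def)
      qed (intro exI[of _ "{}"], simp add: empty_less_kappa)
    qed
    from choice[OF this] obtain F where F: "\<And>x. |F x| <o \<kappa>" "\<And>x. F x \<subseteq> Prods"
        "\<And>x. (x0, x) \<in> |G| \<Longrightarrow> covers (F x) (Z x)" by auto
    \<comment> \<open>\<open>F'\<close> contains everything that may be used below to cover
      \<open>h\<close>, for every \<open>x\<close>. Being smaller than \<open>|L|\<close>, it cannot
      cover the non-thin \<open>D\<close>.\<close>
    define F' where "F' = f ` G \<union> (\<Union>x \<in> G. F x)"
    have "|\<Union>x \<in> G. F x| <o |L|"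
      by (rule card_of_UNION_less_above_regular[OF kappa_Cinfinite kappa_regular L(1) GL F(1)])
    moreover have "|f ` G| <o |L|" using GL by (rule ordLeq_ordLess_trans[OF card_of_image])
    moreover have "infinite L"
      using L(1) kappa_Cinfinite cinfinite_mono by (fastforce simp: cinfinite_def Field_card_of)
    ultimately have "|F'| <o |L|" unfolding F'_def by (intro card_of_Un_ordLess_infinite)
    then have "\<not> covers F' D" using L(2)[OF D] not_ordLess_ordLeq by blast
    moreover have "F' \<subseteq> Prods" unfolding F'_def using f F(2)
      by (simp add: image_subset_iff UN_subset_iff)
    ultimately obtain h where h: "h \<in> Prods" "\<not> covered F' D h" unfolding covers_def by auto
    have "\<exists>a \<in> A. g a \<preceq> f x a \<and> f x a \<preceq> h a" if x: "(x0, x) \<in> |G|" for x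
    proof (rule ccontr)
      assume none: "\<not> ?thesis"
      have xG: "x \<in> G" using FieldI2[OF x] by (simp add: Field_card_of)
      have "covered (F x) (Z x) h" using F(3)[OF x] h(1) by (simp add: covers_def)
      then obtain K \<nu> where K: "K \<subseteq> F x" "|K| <o \<sigma>" "\<nu> \<in> Field \<mu>"
          "\<forall>a \<in> Z x. a \<preceq> \<nu> \<or> (\<exists>k \<in> K. h a \<preceq> k a)" by (rule coveredE)
      \<comment> \<open>Where \<open>f x\<close> is below \<open>g\<close> on \<open>D\<close>, it
        is below \<open>f x0\<close>, and the cover of \<open>Z x\<close> applies. Elsewhere
        \<open>f x\<close> is at least \<open>g\<close>, so in the absence of an escape coordinate
        it exceeds \<open>h\<close>.\<close>
      have "covered F' D h"
      proof (rule coveredI[OF _ _ K(3)])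
        show "K \<union> {f x} \<subseteq> F'" using K(1) xG unfolding F'_def by auto
        show "|K \<union> {f x}| <o \<sigma>"
          using K(2) finite_less_sigma[of "{f x}"] sigma_Cinfinite
          by (intro card_of_Un_ordLess_infinite_Field) (auto simp: cinfinite_def)
        fix a assume "a \<in> D"
        then have a: "a \<in> A" "\<not> f x0 a \<prec> g a" by (simp_all add: D_def)
        have aR: "a \<in> Reg_below \<mu>" using A(1) a(1) by (rule subsetD)
        have Fld: "f x0 a \<in> Field \<mu>" "f x a \<in> Field \<mu>" "g a \<in> Field \<mu>" "h a \<in> Field \<mu>"
          using f x0(1) xG g h(1) Prods_Field[OF _ aR] by simp_all
        show "a \<preceq> \<nu> \<or> (\<exists>k \<in> K \<union> {f x}. h a \<preceq> k a)"
        proof (cases "f x a \<prec> g a")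
          case True
          moreover have "g a \<preceq> f x0 a" using a(2) not_less[OF Fld(1,3)] by simp
          ultimately have "a \<in> Z x" using a(1) less_leq_trans by (simp add: Z_def)
          then show ?thesis using K(4) by auto
        next
          case False
          then have "g a \<preceq> f x a" using not_less[OF Fld(2,3)] by simp
          then have "\<not> f x a \<preceq> h a" using none a(1) by auto
          then have "h a \<preceq> f x a" using not_less[OF Fld(4,2)] less_imp_leq by auto
          then show ?thesis by simp
        qed
      qed
      then show False using h(2) by simp
    qed
    then show "\<exists>h \<in> Prods. \<exists>x0 \<in> Field |G|. \<forall>x. (x0, x) \<in> |G| \<longrightarrow>
       (\<exists>a \<in> A. g a \<preceq> f x a \<and> f x a \<preceq> h a)"
      using h(1) x0(1) by (intro bexI[of _ h] bexI[of _ x0]) (simp_all add: Field_card_of)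
  qed
qed

lemma not_thin_imp_large_PP:
  assumes A: "A \<subseteq> Reg_below \<mu>" "|A| <o \<mu>" "\<And>a. a \<in> A \<Longrightarrow> |A| <o |underS \<mu> a|" "\<not> thin A"
  shows "\<exists>l :: ('a \<Rightarrow> 'a) rel. l \<in> PP_Gamma \<mu> \<sigma> \<mu> \<and> \<kappa> \<le>o l"
proof -
  \<comment> \<open>Minimizing over subsets \<open>B\<close> as well as over families ensures that
    no non-thin subset of the chosen \<open>B\<close> has a cover smaller than \<open>L\<close>, as
    \<open>thin_ideal_directed\<close> requires.\<close>
  define R where "R = card_of ` {F. \<exists>B. B \<subseteq> A \<and> \<not> thin B \<and> covers F B}"
  have "|Prods| \<in> R" unfolding R_def using covers_Prods[OF A(1)] A(4) by auto
  then have "R \<noteq> {}" by auto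
  moreover have "\<forall>c\<in>R. Card_order c" unfolding R_def by (auto simp: card_of_Card_order)
  ultimately have "\<exists>c\<in>R. \<forall>c'\<in>R. c \<le>o c'" by (rule exists_minim_Card_order)
  then obtain c where c: "c \<in> R" "\<forall>c'\<in>R. c \<le>o c'" by (elim bexE)
  from c(1) obtain B L where BL: "c = |L|" "B \<subseteq> A" "\<not> thin B" "covers L B"
    unfolding R_def by auto
  have least: "|L| \<le>o |F|" if "C \<subseteq> B" "\<not> thin C" "covers F C" for C F
  proof -
    have "|F| \<in> R" unfolding R_def using that BL(2) by auto
    then show ?thesis using c(2) BL(1) by simp
  qed
  have "Well_order \<kappa>" using kappa_Cinfinite by (simp add: card_order_on_def)
  moreover have "\<not> |L| <o \<kappa>" using BL(3,4) unfolding thin_def by auto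
  ultimately have \<kappa>L: "\<kappa> \<le>o |L|" using not_ordLess_iff_ordLeq[OF _ card_of_Well_order] by blast
  have BR: "B \<subseteq> Reg_below \<mu>" using BL(2) A(1) by auto
  have cB: "|B| \<le>o |A|" by (rule card_of_mono1[OF BL(2)])
  have B: "|B| <o |underS \<mu> a|" if "a \<in> B" for a
    using A(3) that BL(2) ordLeq_ordLess_trans[OF cB] by auto
  let ?J = "thin_ideal B"
  have J: "good_ideal B ?J" by (rule thin_ideal_good[OF BR BL(3)])
  have LP: "L \<subseteq> Prods" using BL(4) by (simp add: covers_def)
  \<comment> \<open>A bound \<open>g\<close> of \<open>L\<close> would itself be covered by fewer
    than \<sigma> members of \<open>L\<close>, each strictly below \<open>g\<close> modulo the
    ideal; by \<sigma>-completeness \<open>B\<close> would be thin.\<close>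
  have unb: "\<not> bounded_mod B ?J L"
  proof
    assume "bounded_mod B ?J L"
    then obtain g where g: "g \<in> Prods" "\<forall>h \<in> L. less_mod \<mu> B ?J h g"
      unfolding bounded_mod_def by (rule bexE)
    have "covered L B g" using BL(4) g(1) by (simp add: covers_def)
    then obtain H \<nu> where H: "H \<subseteq> L" "|H| <o \<sigma>" "\<nu> \<in> Field \<mu>"
      "\<forall>a \<in> B. a \<preceq> \<nu> \<or> (\<exists>h \<in> H. g a \<preceq> h a)" by (rule coveredE)
    have "(\<Union>h \<in> H. {a \<in> B. \<not> h a \<prec> g a}) \<in> ?J"
    proof (rule good_ideal_UN[OF J H(2)])
      fix h assume "h \<in> H"
      then show "{a \<in> B. \<not> h a \<prec> g a} \<in> ?J"
        using g(2) subsetD[OF H(1)] by (simp add: less_mod_iff)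
    qed
    then have "{a \<in> B. a \<preceq> \<nu>} \<union> (\<Union>h \<in> H. {a \<in> B. \<not> h a \<prec> g a}) \<in> ?J"
      by (rule good_ideal_Un[OF J good_ideal_bounded[OF J H(3)]])
    moreover have "B \<subseteq> {a \<in> B. a \<preceq> \<nu>} \<union> (\<Union>h \<in> H. {a \<in> B. \<not> h a \<prec> g a})"
    proof
      fix a assume a: "a \<in> B"
      then show "a \<in> {a \<in> B. a \<preceq> \<nu>} \<union> (\<Union>h \<in> H. {a \<in> B. \<not> h a \<prec> g a})"
        using bspec[OF H(4) a] leq_less_trans less_irrefl by fastforce
    qed
    ultimately have "B \<in> ?J" by (rule good_ideal_subset[OF J])
    then show False using good_ideal_proper[OF J] by simp
  qed
  have directed: "bounded_mod B ?J H" if "H \<subseteq> Prods" "|H| <o |L|" for H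
    by (rule thin_ideal_directed[OF BR B BL(3) \<kappa>L least that])
  note seq = increasing_sequence[OF J LP unb directed]
  from seq(4) obtain f where f: "\<forall>x \<in> L. f x \<in> Prods \<and> less_mod \<mu> B ?J x (f x) \<and>
       (\<forall>y \<in> underS |L| x. less_mod \<mu> B ?J (f y) (f x))" by (rule exE)
  have tcf: "is_tcf \<mu> B ?J |L|"
    unfolding is_tcf_def
  proof (intro conjI exI[of _ "\<lambda>x. restrict (f x) B"] ballI allI impI)
    show "infinite_regular |L|" unfolding infinite_regular_def using seq(2,3) by simp
  next
    fix x assume "x \<in> Field |L|"
    then have "f x \<in> Prods" using f by (simp add: Field_card_of)
    then show "restrict (f x) B \<in> Pi\<^sub>E B (underS \<mu>)" using BR by (auto simp: Prods_def)
  next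
    fix x y assume xy: "x \<noteq> y \<and> (x, y) \<in> |L|"
    then have "y \<in> L" using FieldI2[of x y "|L|"] by (simp add: Field_card_of)
    moreover have "x \<in> underS |L| y" using xy by (simp add: underS_def)
    ultimately have "less_mod \<mu> B ?J (f x) (f y)" using f by simp
    then show "less_mod \<mu> B ?J (restrict (f x) B) (restrict (f y) B)"
      by (simp add: less_mod_def cong: conj_cong)
  next
    fix g assume g: "g \<in> Pi\<^sub>E B (underS \<mu>)"
    have "Prods \<noteq> {}" using seq(2) LP by (auto simp: cinfinite_def Field_card_of)
    then obtain k where k: "k \<in> Prods" by auto
    \<comment> \<open>Covering concerns functions on all of \<open>Reg_below \<mu>\<close>, so
      \<open>g\<close> is extended off \<open>B\<close> by an arbitrary \<open>k\<close>.\<close>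
    define g' where "g' a = (if a \<in> B then g a else k a)" for a
    have "g' \<in> Prods" using g k by (auto simp: g'_def Prods_def)
    then have "covered L B g'" using BL(4) by (simp add: covers_def)
    then obtain H \<nu> where H: "H \<subseteq> L" "|H| <o \<sigma>" "\<nu> \<in> Field \<mu>"
      "\<forall>a \<in> B. a \<preceq> \<nu> \<or> (\<exists>h \<in> H. g' a \<preceq> h a)" by (rule coveredE)
    \<comment> \<open>Read as indices, the members of \<open>H\<close> have an upper bound
      \<open>x\<close> by regularity of \<open>|L|\<close>. Then \<open>f x\<close> exceeds each of
      them modulo the ideal, hence dominates \<open>g'\<close> by \<sigma>-completeness.\<close>
    have "|H| <o |L|"
      using H(2) sigma_less_mu seq(1) by (blast intro: ordLess_transitive ordLess_ordLeq_trans)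
    then obtain x where x: "x \<in> L" "\<forall>h \<in> H. h \<in> underS |L| x"
      using regular_strict_bound[OF seq(2,3), of H] H(1) by (auto simp: Field_card_of)
    have "(\<Union>h \<in> H. {a \<in> B. \<not> h a \<prec> f x a}) \<in> ?J"
    proof (rule good_ideal_UN[OF J H(2)])
      fix h assume h: "h \<in> H"
      then have "less_mod \<mu> B ?J h (f h)" "less_mod \<mu> B ?J (f h) (f x)"
        using f x subsetD[OF H(1)] by simp_all
      then have "less_mod \<mu> B ?J h (f x)" by (rule less_mod_trans[OF J])
      then show "{a \<in> B. \<not> h a \<prec> f x a} \<in> ?J" by (simp add: less_mod_iff)
    qed
    then have "{a \<in> B. a \<preceq> \<nu>} \<union> (\<Union>h \<in> H. {a \<in> B. \<not> h a \<prec> f x a}) \<in> ?J"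
      by (rule good_ideal_Un[OF J good_ideal_bounded[OF J H(3)]])
    moreover have "{a \<in> B. (g a, restrict (f x) B a) \<notin> \<mu>} \<subseteq>
        {a \<in> B. a \<preceq> \<nu>} \<union> (\<Union>h \<in> H. {a \<in> B. \<not> h a \<prec> f x a})"
    proof
      fix a assume "a \<in> {a \<in> B. (g a, restrict (f x) B a) \<notin> \<mu>}"
      then have a: "a \<in> B" "\<not> g' a \<preceq> f x a" by (auto simp: g'_def)
      then show "a \<in> {a \<in> B. a \<preceq> \<nu>} \<union> (\<Union>h \<in> H. {a \<in> B. \<not> h a \<prec> f x a})"
        using bspec[OF H(4) a(1)] leq_trans less_imp_leq by fastforce
    qed
    ultimately have "le_mod \<mu> B ?J g (restrict (f x) B)"
      unfolding le_mod_def by (rule good_ideal_subset[OF J])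
    then show "\<exists>x \<in> Field |L|. le_mod \<mu> B ?J g (restrict (f x) B)"
      using x(1) by (intro bexI[of _ x]) (simp_all add: Field_card_of)
  qed
  have "cofinal B \<mu>"
    unfolding cofinal_def
  proof (rule ballI, rule ccontr)
    fix b assume b: "b \<in> Field \<mu>" "\<not> (\<exists>x \<in> B. b \<noteq> x \<and> b \<preceq> x)"
    then have "\<forall>x \<in> B. x \<preceq> b"
      using not_less[OF b(1)] BR Reg_below_Field by (auto simp: underS_def)
    then show False using thin_bounded[OF b(1)] BL(3) by simp
  qed
  moreover have "|B| <o \<mu>" using A(2) by (rule ordLeq_ordLess_trans[OF cB])
  ultimately have "|L| \<in> PP_Gamma \<mu> \<sigma> \<mu>"
    unfolding PP_Gamma_def using J tcf BR
    by (auto simp: good_ideal_def card_of_Card_order intro!: exI[of _ B] exI[of _ ?J])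
  then show ?thesis using \<kappa>L by (intro exI[of _ "|L|"] conjI)
qed

end

subsection \<open>Ladders and covering families\<close>

context pp_setting
begin

lemma card_less_segment_card:
  assumes "|S| <o \<mu>"
  shows "\<exists>a \<in> Field \<mu>. |S| =o Restr \<mu> (underS \<mu> a) \<and> |S| =o |underS \<mu> a|"
proof -
  obtain a where a: "a \<in> Field \<mu>" "|S| =o Restr \<mu> (underS \<mu> a)"
    using card_less_segment[OF assms] by blast
  have "Card_order (Restr \<mu> (underS \<mu> a))"
    using Card_order_ordIso2[OF card_of_Card_order a(2)] .
  then have "|underS \<mu> a| =o Restr \<mu> (underS \<mu> a)"
    using card_of_Field_ordIso[of "Restr \<mu> (underS \<mu> a)"] by (simp add: Field_segment)
  then have "|S| =o |underS \<mu> a|"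
    using a(2) ordIso_symmetric ordIso_transitive by blast
  with a show ?thesis by blast
qed

text \<open>
  For infinite \<open>e\<close> the ordinal \<open>\<gamma>\<close> is the cofinality of \<open>\<beta>\<close>, and \<open>p\<close> maps it cofinally, though
  not necessarily monotonically, into \<open>\<beta>\<close>.
\<close>

definition ladder :: "'a \<Rightarrow> 'a set \<Rightarrow> 'a \<Rightarrow> ('a \<Rightarrow> 'a) \<Rightarrow> bool" where
  "ladder \<beta> e \<gamma> p \<longleftrightarrow> e \<subseteq> underS \<mu> \<beta> \<and> (\<forall>x. x \<prec> \<beta> \<longrightarrow> (\<exists>y \<in> e. x \<preceq> y)) \<and>
     (infinite e \<longrightarrow> \<gamma> \<in> Reg_below \<mu> \<and> |e| =o |underS \<mu> \<gamma>| \<and> (\<forall>j. j \<prec> \<gamma> \<longrightarrow> p j \<prec> \<beta>) \<and>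
       (\<forall>x. x \<prec> \<beta> \<longrightarrow> (\<exists>i. i \<prec> \<gamma> \<and> (\<forall>j. j \<prec> \<gamma> \<and> i \<preceq> j \<longrightarrow> x \<preceq> p j))))"

text \<open>Let \<open>e\<close> be cofinal in \<open>\<beta>\<close> of least size and
  \<open>w\<close> an enumeration of it by its initial ordinal \<open>\<gamma>\<close>. Fewer than
  \<open>|e|\<close> points are not cofinal, so \<open>p j\<close> can be chosen above all
  \<open>w i\<close> with \<open>i\<close> up to \<open>j\<close>. For the same reason
  \<open>\<gamma>\<close> is regular: \<open>p\<close> would carry a smaller cofinal subset of
  \<open>\<gamma>\<close> to one of \<open>\<beta>\<close>.\<close>

lemma ladder_exists:
  assumes \<beta>: "\<beta> \<in> Field \<mu>"
  shows "\<exists>e \<gamma> p. ladder \<beta> e \<gamma> p"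
proof -
  define cof where "cof e \<longleftrightarrow> e \<subseteq> underS \<mu> \<beta> \<and> (\<forall>x. x \<prec> \<beta> \<longrightarrow> (\<exists>y \<in> e. x \<preceq> y))" for e
  define R where "R = card_of ` {e. cof e}"
  have "cof (underS \<mu> \<beta>)" unfolding cof_def using leq_refl less_Field(1) by blast
  then have "R \<noteq> {}" unfolding R_def by auto
  moreover have "\<forall>c\<in>R. Card_order c" unfolding R_def by (auto simp: card_of_Card_order)
  ultimately have "\<exists>c\<in>R. \<forall>c'\<in>R. c \<le>o c'" by (rule exists_minim_Card_order)
  then obtain c where c: "c \<in> R" "\<forall>c'\<in>R. c \<le>o c'" by (elim bexE)
  from c(1) obtain e where e: "c = |e|" "cof e" unfolding R_def by (elim imageE) simp
  have not_cof: "\<not> cof S" if "|S| <o |e|" for S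
  proof
    assume "cof S"
    then have "|e| \<le>o |S|" using c(2) e(1) by (simp add: R_def)
    then show False using that not_ordLess_ordLeq by blast
  qed
  show ?thesis
  proof (cases "finite e")
    case True
    then show ?thesis using e(2) unfolding ladder_def cof_def by blast
  next
    case False
    have "|e| \<le>o |underS \<mu> \<beta>|" using e(2) unfolding cof_def by (intro card_of_mono1) simp
    then have "|e| <o \<mu>" using card_segment_less_mu[OF \<beta>] ordLeq_ordLess_trans by blast
    then obtain \<gamma> where \<gamma>: "\<gamma> \<in> Field \<mu>" "|e| =o Restr \<mu> (underS \<mu> \<gamma>)" "|e| =o |underS \<mu> \<gamma>|"
      using card_less_segment_card[of e] by blast
    let ?r = "Restr \<mu> (underS \<mu> \<gamma>)"
    have Card: "Card_order ?r" using Card_order_ordIso2[OF card_of_Card_order \<gamma>(2)] .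
    have infr: "infinite (underS \<mu> \<gamma>)"
      using \<gamma>(3) False card_of_ordLeq_finite ordIso_imp_ordLeq by blast
    obtain w where w: "bij_betw w (underS \<mu> \<gamma>) e"
      using \<gamma>(3) ordIso_symmetric card_of_ordIso by blast
    have we: "w i \<prec> \<beta>" if "i \<prec> \<gamma>" for i
      using bij_betwE[OF w] that e(2) unfolding cof_def by blast
    have "\<exists>z. z \<prec> \<beta> \<and> (\<forall>i. i \<preceq> j \<longrightarrow> w i \<preceq> z)" if j: "j \<prec> \<gamma>" for j
    proof -
      let ?S = "w ` underS \<mu> j \<union> {w j}"
      have "underS \<mu> j \<subseteq> underS ?r j"
        using j less_trans[of _ j \<gamma>] by (auto simp: underS_def)
      then have "|underS \<mu> j| \<le>o |underS ?r j|" by (rule card_of_mono1)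
      moreover have "|underS ?r j| <o ?r"
        using card_of_underS[OF Card, of j] j Field_segment by simp
      ultimately have "|underS \<mu> j| <o |e|"
        using \<gamma>(2) ordIso_symmetric ordLeq_ordLess_trans ordLess_ordIso_trans by blast
      then have "|w ` underS \<mu> j| <o |e|" by (rule ordLeq_ordLess_trans[OF card_of_image])
      then have "|?S| <o |e|"
        using finite_card_less_infinite[OF _ False, of "{w j}"]
        by (intro card_of_Un_ordLess_infinite[OF False]) simp_all
      then have "\<not> cof ?S" by (rule not_cof)
      moreover have sub: "?S \<subseteq> underS \<mu> \<beta>" using we j less_trans by blast
      ultimately obtain z where z: "z \<prec> \<beta>" "\<forall>y \<in> ?S. \<not> z \<preceq> y"
        unfolding cof_def by blast
      have "w i \<preceq> z" if "i \<preceq> j" for i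
      proof -
        have "w i \<in> ?S" using less_or_eq[OF that] by blast
        then show ?thesis
          using z sub not_less[of z "w i"] less_imp_leq less_Field(1) by blast
      qed
      with z(1) show ?thesis by blast
    qed
    then have "\<forall>j \<in> underS \<mu> \<gamma>. \<exists>z. z \<prec> \<beta> \<and> (\<forall>i. i \<preceq> j \<longrightarrow> w i \<preceq> z)" by simp
    from bchoice[OF this] obtain p where p: "\<And>j. j \<prec> \<gamma> \<Longrightarrow> p j \<prec> \<beta>"
        "\<And>i j. j \<prec> \<gamma> \<Longrightarrow> i \<preceq> j \<Longrightarrow> w i \<preceq> p j" by auto
    have idx: "\<exists>i. i \<prec> \<gamma> \<and> (\<forall>j. j \<prec> \<gamma> \<and> i \<preceq> j \<longrightarrow> x \<preceq> p j)" if x: "x \<prec> \<beta>" for x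
    proof -
      obtain y where y: "y \<in> e" "x \<preceq> y" using e(2) x unfolding cof_def by blast
      obtain i where i: "i \<prec> \<gamma>" "y = w i" using w y(1) unfolding bij_betw_def by blast
      then show ?thesis using p(2) y(2) leq_trans by blast
    qed
    have "regularCard ?r"
      unfolding regularCard_def
    proof (intro allI impI, rule ccontr)
      fix K assume K: "K \<subseteq> Field ?r \<and> cofinal K ?r" and nK: "\<not> |K| =o ?r"
      have Kg: "K \<subseteq> underS \<mu> \<gamma>" using K Field_segment by simp
      have "|K| \<le>o |e|"
        using card_of_mono1[OF Kg] \<gamma>(3) ordIso_symmetric ordLeq_ordIso_trans by blast
      moreover have "\<not> |K| =o |e|" using nK \<gamma>(2) ordIso_transitive by blast
      ultimately have "|K| <o |e|" using ordLeq_iff_ordLess_or_ordIso by blast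
      then have "|p ` K| <o |e|" by (rule ordLeq_ordLess_trans[OF card_of_image])
      then have "\<not> cof (p ` K)" by (rule not_cof)
      moreover have "p ` K \<subseteq> underS \<mu> \<beta>" using p(1) Kg by blast
      ultimately obtain x where x: "x \<prec> \<beta>" "\<forall>y \<in> p ` K. \<not> x \<preceq> y" unfolding cof_def by blast
      obtain i where i: "i \<prec> \<gamma>" "\<forall>j. j \<prec> \<gamma> \<and> i \<preceq> j \<longrightarrow> x \<preceq> p j" using idx[OF x(1)] by blast
      have "i \<in> Field ?r" using i(1) Field_segment by simp
      then obtain k where "k \<in> K" "(i, k) \<in> ?r" using K unfolding cofinal_def by blast
      then show False using i(2) x(2) Kg by blast
    qed
    then have "\<gamma> \<in> Reg_below \<mu>"
      using \<gamma>(1) Card infr Field_segment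
      by (simp add: Reg_below_def infinite_regular_def cinfinite_def)
    then have "ladder \<beta> e \<gamma> p"
      unfolding ladder_def using e(2) \<gamma>(3) p(1) idx unfolding cof_def by blast
    then show ?thesis by blast
  qed
qed

lemma Prods_nonempty: "\<exists>k. k \<in> Prods"
  using pointwise_strict_bound[of "{}" "\<lambda>_ _. undefined"] by auto

section \<open>True cofinalities in \<open>PP_Gamma\<close> compared with \<mu> and with covering
  families\<close>

lemma good_ideal_PP:
  assumes "l \<in> PP_Gamma \<mu> \<sigma> \<mu>"
  obtains A J where "good_ideal A J" "|A| <o \<mu>" "is_tcf \<mu> A J l"
  using assms unfolding PP_Gamma_def good_ideal_def by auto

lemma good_ideal_Pi:
  assumes "good_ideal A J" "g \<in> Prods"
  shows "restrict g A \<in> Pi\<^sub>E A (underS \<mu>)"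
  using assms by (auto simp: good_ideal_def Prods_def)

text \<open>A regular \<open>l\<close> differs from the singular \<mu>. If it were smaller, a
  sequence of length \<open>l\<close> would have a strict bound modulo \<open>J\<close>, and
  cofinality would put that bound below a member of the sequence.\<close>

lemma mu_less_PP:
  fixes l :: "'l rel"
  assumes "l \<in> PP_Gamma \<mu> \<sigma> \<mu>"
  shows "\<mu> <o l"
proof (rule ccontr)
  assume "\<not> \<mu> <o l"
  obtain A J where J: "good_ideal A J" "is_tcf \<mu> A J l" by (rule good_ideal_PP[OF assms])
  have l: "Cinfinite l" "regularCard l"
    using J(2) by (simp_all add: is_tcf_def infinite_regular_def)
  have "l \<le>o \<mu>"
    using \<open>\<not> \<mu> <o l\<close> l(1) not_ordLess_iff_ordLeq[OF _ mu_Well, of l]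
    by (simp add: card_order_on_def)
  moreover have "\<not> l =o \<mu>"
    using regularCard_ordIso[of l \<mu>] l mu_singular by (auto simp: singular_def)
  ultimately have lmu: "l <o \<mu>" using ordLeq_iff_ordLess_or_ordIso by blast
  obtain f where f: "\<forall>\<alpha> \<in> Field l. f \<alpha> \<in> Pi\<^sub>E A (underS \<mu>)"
      "\<forall>g \<in> Pi\<^sub>E A (underS \<mu>). \<exists>\<alpha> \<in> Field l. le_mod \<mu> A J g (f \<alpha>)"
    using J(2) unfolding is_tcf_def by (elim conjE exE)
  obtain k where k: "k \<in> Prods" using Prods_nonempty by auto
  define f' where "f' \<alpha> a = (if a \<in> A then f \<alpha> a else k a)" for \<alpha> a
  have "f' ` Field l \<subseteq> Prods"
  proof (rule image_subsetI)
    fix \<alpha> assume "\<alpha> \<in> Field l"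
    then have "f \<alpha> \<in> Pi\<^sub>E A (underS \<mu>)" using f(1) by simp
    then show "f' \<alpha> \<in> Prods" using k by (auto simp: Prods_def f'_def)
  qed
  moreover have "|f' ` Field l| <o \<mu>"
    by (rule ordLeq_ordLess_trans[OF card_of_image ordLess_Field[OF lmu]])
  ultimately have "bounded_mod A J (f' ` Field l)" by (rule small_bounded_mod[OF J(1)])
  then obtain g where g: "g \<in> Prods" "\<forall>h \<in> f' ` Field l. less_mod \<mu> A J h g"
    unfolding bounded_mod_def by (rule bexE)
  obtain \<alpha> where \<alpha>: "\<alpha> \<in> Field l" "le_mod \<mu> A J (restrict g A) (f \<alpha>)"
    using bspec[OF f(2) good_ideal_Pi[OF J(1) g(1)]] by (rule bexE)
  have "less_mod \<mu> A J (f' \<alpha>) g" using g(2) \<alpha>(1) by simp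
  then have "{a \<in> A. \<not> f' \<alpha> a \<prec> g a} \<union> {a \<in> A. (restrict g A a, f \<alpha> a) \<notin> \<mu>} \<in> J"
    using \<alpha>(2) good_ideal_Un[OF J(1)] by (simp add: less_mod_iff le_mod_def)
  moreover have "A \<subseteq> {a \<in> A. \<not> f' \<alpha> a \<prec> g a} \<union> {a \<in> A. (restrict g A a, f \<alpha> a) \<notin> \<mu>}"
    using less_leq_trans less_irrefl by (fastforce simp: f'_def)
  ultimately have "A \<in> J" by (rule good_ideal_subset[OF J(1)])
  then show False using good_ideal_proper[OF J(1)] by simp
qed

text \<open>For each \<open>B\<close> in \<open>M\<close>, bound the part of \<open>B\<close> below
  \<open>a\<close>, for \<open>a\<close> larger than \<open>|B|\<close>, by a function, and place
  this function below some member of the scale \<open>f\<close>. If \<open>|M|\<close> were below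
  \<open>l\<close>, a single \<open>f \<xi>\<close> would lie above all of these, so
  \<open>f \<xi> a\<close> would avoid each \<open>B\<close> at almost all \<open>a\<close>. But
  fewer than \<sigma> sets \<open>B\<close> cover the range of \<open>f \<xi>\<close>.\<close>

lemma covering_family_ge_PP:
  fixes l :: "'l rel"
  assumes M: "\<And>B. B \<in> M \<Longrightarrow> |B| <o \<mu>"
    and cover: "\<And>X. X \<subseteq> Field \<mu> \<Longrightarrow> |X| <o \<mu> \<Longrightarrow> \<exists>S. S \<subseteq> M \<and> |S| <o \<sigma> \<and> X \<subseteq> \<Union>S"
    and l: "l \<in> PP_Gamma \<mu> \<sigma> \<mu>"
  shows "\<not> |M| <o l"
proof
  assume Ml: "|M| <o l"
  obtain A J where J: "good_ideal A J" "|A| <o \<mu>" "is_tcf \<mu> A J l" by (rule good_ideal_PP[OF l])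
  have lreg: "Cinfinite l" "regularCard l"
    using J(3) by (simp_all add: is_tcf_def infinite_regular_def)
  obtain f where f: "\<forall>\<alpha> \<in> Field l. f \<alpha> \<in> Pi\<^sub>E A (underS \<mu>)"
      "\<forall>\<alpha> \<beta>. \<alpha> \<noteq> \<beta> \<and> (\<alpha>, \<beta>) \<in> l \<longrightarrow> less_mod \<mu> A J (f \<alpha>) (f \<beta>)"
      "\<forall>g \<in> Pi\<^sub>E A (underS \<mu>). \<exists>\<alpha> \<in> Field l. le_mod \<mu> A J g (f \<alpha>)"
    using J(3) unfolding is_tcf_def by (elim conjE exE)
  obtain k where k: "k \<in> Prods" using Prods_nonempty by auto
  define Q where "Q B q \<longleftrightarrow> snd q \<in> Field l \<and> le_mod \<mu> A J (restrict (fst q) A) (f (snd q)) \<and>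
      (\<forall>a \<in> A. |B| <o |underS \<mu> a| \<longrightarrow> (\<forall>y \<in> B. y \<prec> a \<longrightarrow> y \<prec> fst q a))" for B q
  have "\<forall>B \<in> M. \<exists>q. Q B q"
  proof
    fix B assume "B \<in> M"
    \<comment> \<open>Elements of \<open>B\<close> not below \<open>a\<close> are replaced by
      \<open>k a\<close>, so that the family of values stays inside the product.\<close>
    have "\<exists>h \<in> Prods. \<forall>a \<in> Reg_below \<mu>. |B| <o |underS \<mu> a| \<longrightarrow>
        (\<forall>y \<in> B. (if y \<prec> a then y else k a) \<prec> h a)"
      by (rule pointwise_strict_bound) (use Prods_less[OF k] in simp)
    then obtain h where h: "h \<in> Prods" "\<forall>a \<in> Reg_below \<mu>. |B| <o |underS \<mu> a| \<longrightarrow>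
        (\<forall>y \<in> B. (if y \<prec> a then y else k a) \<prec> h a)" by (rule bexE)
    obtain \<alpha> where "\<alpha> \<in> Field l" "le_mod \<mu> A J (restrict h A) (f \<alpha>)"
      using bspec[OF f(3) good_ideal_Pi[OF J(1) h(1)]] by (rule bexE)
    moreover have "\<forall>a \<in> A. |B| <o |underS \<mu> a| \<longrightarrow> (\<forall>y \<in> B. y \<prec> a \<longrightarrow> y \<prec> h a)"
    proof (intro ballI impI)
      fix a y assume "a \<in> A" "|B| <o |underS \<mu> a|" "y \<in> B" "y \<prec> a"
      then have "(if y \<prec> a then y else k a) \<prec> h a"
        using h(2) good_ideal_Reg[OF J(1)] by metis
      then show "y \<prec> h a" using \<open>y \<prec> a\<close> by simp
    qed
    ultimately have "Q B (h, \<alpha>)" by (simp add: Q_def)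
    then show "\<exists>q. Q B q" by (rule exI[of _ "(h, \<alpha>)"])
  qed
  from bchoice[OF this] obtain q where q: "\<And>B. B \<in> M \<Longrightarrow> Q B (q B)" by auto
  let ?X = "(\<lambda>B. snd (q B)) ` M"
  have "?X \<subseteq> Field l" using q by (auto simp: Q_def)
  moreover have "|?X| <o l" using Ml by (rule ordLeq_ordLess_trans[OF card_of_image])
  ultimately obtain \<xi> where \<xi>: "\<xi> \<in> Field l" "\<forall>x \<in> ?X. x \<in> underS l \<xi>"
    using regular_strict_bound[OF lreg, of ?X] by auto
  have f\<xi>: "f \<xi> a \<prec> a" if "a \<in> A" for a using f(1) \<xi>(1) that by auto
  have "f \<xi> ` A \<subseteq> Field \<mu>" using f\<xi> less_Field(1) by blast
  moreover have "|f \<xi> ` A| <o \<mu>" using J(2) by (rule ordLeq_ordLess_trans[OF card_of_image])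
  ultimately obtain S where S: "S \<subseteq> M" "|S| <o \<sigma>" "f \<xi> ` A \<subseteq> \<Union>S"
    using cover[of "f \<xi> ` A"] by auto
  have "(\<Union>B \<in> S. {a \<in> A. f \<xi> a \<in> B}) \<in> J"
  proof (rule good_ideal_UN[OF J(1) S(2)])
    fix B assume "B \<in> S"
    then have B: "B \<in> M" using S(1) by auto
    let ?h = "fst (q B)" and ?g = "f (snd (q B))"
    obtain b where b: "b \<in> Field \<mu>" "\<forall>a \<in> Reg_below \<mu>. a \<preceq> b \<or> |B| <o |underS \<mu> a|"
      using Reg_below_above_card[OF M[OF B]] by auto
    have "snd (q B) \<in> underS l \<xi>" using \<xi>(2) B by simp
    then have "less_mod \<mu> A J ?g (f \<xi>)" using f(2) by (simp add: underS_def)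
    then have "{a \<in> A. \<not> ?g a \<prec> f \<xi> a} \<in> J" by (simp add: less_mod_iff)
    moreover have "{a \<in> A. (restrict ?h A a, ?g a) \<notin> \<mu>} \<in> J"
      using q[OF B] by (simp add: Q_def le_mod_def)
    ultimately have "{a \<in> A. a \<preceq> b} \<union> ({a \<in> A. \<not> ?g a \<prec> f \<xi> a} \<union>
        {a \<in> A. (restrict ?h A a, ?g a) \<notin> \<mu>}) \<in> J"
      by (intro good_ideal_Un[OF J(1)] good_ideal_bounded[OF J(1) b(1)])
    moreover have "{a \<in> A. f \<xi> a \<in> B} \<subseteq> {a \<in> A. a \<preceq> b} \<union> ({a \<in> A. \<not> ?g a \<prec> f \<xi> a} \<union>
        {a \<in> A. (restrict ?h A a, ?g a) \<notin> \<mu>})"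
    proof
      fix a assume "a \<in> {a \<in> A. f \<xi> a \<in> B}"
      then have a: "a \<in> A" "f \<xi> a \<in> B" by auto
      have "False" if "\<not> a \<preceq> b" "?g a \<prec> f \<xi> a" "?h a \<preceq> ?g a"
      proof -
        have "|B| <o |underS \<mu> a|" using b(2) good_ideal_Reg[OF J(1) a(1)] that(1) by auto
        then have "f \<xi> a \<prec> ?h a" using q[OF B] a f\<xi>[OF a(1)] by (simp add: Q_def)
        then have "f \<xi> a \<prec> f \<xi> a"
          using less_leq_trans[OF _ that(3)] less_trans[OF _ that(2)] by blast
        then show False by (simp add: less_irrefl)
      qed
      then show "a \<in> {a \<in> A. a \<preceq> b} \<union> ({a \<in> A. \<not> ?g a \<prec> f \<xi> a} \<union>
        {a \<in> A. (restrict ?h A a, ?g a) \<notin> \<mu>})" using a(1) by auto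
    qed
    ultimately show "{a \<in> A. f \<xi> a \<in> B} \<in> J" by (rule good_ideal_subset[OF J(1)])
  qed
  moreover have "A \<subseteq> (\<Union>B \<in> S. {a \<in> A. f \<xi> a \<in> B})" using S(3) by auto
  ultimately have "A \<in> J" by (rule good_ideal_subset[OF J(1)])
  then show False using good_ideal_proper[OF J(1)] by simp
qed

end

section \<open>Covering the small subsets of \<mu> when all progressive sets are thin\<close>

context pp_target
begin

text \<open>\<open>M\<close> is the closure of a cofinal set \<open>K\<close> under an operation
  \<open>N\<close> with fewer than \<kappa> results, none depending on \<open>X\<close>. For a given
  \<open>X\<close>, fewer than \<sigma> of these results lower the approximations of all
  \<open>x\<close> in \<open>X\<close> simultaneously, and approximations cannot decrease
  forever.\<close>

lemma covering_family_exists: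
  assumes thin: "\<And>A. A \<subseteq> Reg_below \<mu> \<Longrightarrow> |A| <o \<mu> \<Longrightarrow> \<forall>a \<in> A. |A| <o |underS \<mu> a| \<Longrightarrow> thin A"
  shows "\<exists>M. |M| <o \<kappa> \<and> (\<forall>B \<in> M. |B| <o \<mu>) \<and>
    (\<forall>X. X \<subseteq> Field \<mu> \<and> |X| <o \<mu> \<longrightarrow> (\<exists>S. S \<subseteq> M \<and> |S| <o \<sigma> \<and> X \<subseteq> \<Union>S))"
proof -
  obtain K where K: "K \<subseteq> Field \<mu>" "cofinal K \<mu>" "|K| <o \<mu>" "infinite K"
    by (rule small_cofinal_set)
  have Un: "|X \<union> Y| <o \<mu>" if "|X| <o \<mu>" "|Y| <o \<mu>" for X Y :: "'a set"
    using that mu_Cinfinite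
    by (intro card_of_Un_ordLess_infinite_Field) (simp_all add: cinfinite_def)
  have "\<forall>\<beta> \<in> Field \<mu>. \<exists>t. ladder \<beta> (fst t) (fst (snd t)) (snd (snd t))"
  proof
    fix \<beta> assume "\<beta> \<in> Field \<mu>"
    then obtain e \<gamma> p where "ladder \<beta> e \<gamma> p" using ladder_exists by blast
    then show "\<exists>t. ladder \<beta> (fst t) (fst (snd t)) (snd (snd t))"
      by (intro exI[of _ "(e, \<gamma>, p)"]) simp
  qed
  from bchoice[OF this] obtain t where
    "\<forall>\<beta> \<in> Field \<mu>. ladder \<beta> (fst (t \<beta>)) (fst (snd (t \<beta>))) (snd (snd (t \<beta>)))" by (rule exE)
  then obtain e c p where lad: "\<And>\<beta>. \<beta> \<in> Field \<mu> \<Longrightarrow> ladder \<beta> (e \<beta>) (c \<beta>) (p \<beta>)"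
    using that[of "\<lambda>\<beta>. fst (t \<beta>)" "\<lambda>\<beta>. fst (snd (t \<beta>))" "\<lambda>\<beta>. snd (snd (t \<beta>))"] by simp
  have "\<forall>A. \<exists>F. |F| <o \<kappa> \<and> F \<subseteq> Prods \<and> (thin A \<longrightarrow> covers F A)"
  proof
    fix A
    show "\<exists>F. |F| <o \<kappa> \<and> F \<subseteq> Prods \<and> (thin A \<longrightarrow> covers F A)"
    proof (cases "thin A")
      case True
      then obtain F where "|F| <o \<kappa>" "covers F A" unfolding thin_def by auto
      then show ?thesis by (intro exI[of _ F]) (simp add: covers_def)
    qed (intro exI[of _ "{}"], simp add: empty_less_kappa)
  qed
  from choice[OF this] obtain \<F> where \<F>: "\<And>A. |\<F> A| <o \<kappa>" "\<And>A. \<F> A \<subseteq> Prods"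
      "\<And>A. thin A \<Longrightarrow> covers (\<F> A) A" by auto
  \<comment> \<open>Keeping only cofinalities larger than \<open>|underS \<mu> \<nu>|\<close> makes
    this set progressive once \<open>\<nu>\<close> bounds the size of \<open>B\<close>.\<close>
  define cofs where "cofs B \<nu> = {\<gamma> \<in> Reg_below \<mu>. \<gamma> \<in> c ` B \<and> |underS \<mu> \<nu>| <o |underS \<mu> \<gamma>|}" for B \<nu>
  \<comment> \<open>Short ladders are included whole. Of a long ladder, \<open>big\<close> takes
    only the rung that \<open>h\<close> indicates at the cofinality of \<open>\<beta>\<close>, so it
    adds at most \<open>|B|\<close> points.\<close>
  define small where "small B \<nu> = (\<Union>\<beta> \<in> {\<beta> \<in> B. |e \<beta>| \<le>o |underS \<mu> \<nu>|}. e \<beta>)" for B \<nu>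
  define big where "big B h = (\<lambda>\<beta>. p \<beta> (h (c \<beta>))) ` {\<beta> \<in> B. infinite (e \<beta>)}" for B h
  \<comment> \<open>The appropriate cutoffs and guesses depend on \<open>X\<close>, so all of them
    are included.\<close>
  define N where "N B = small B ` Field \<mu> \<union> (\<Union>\<nu> \<in> Field \<mu>. big B ` \<F> (cofs B \<nu>))" for B
  define M where "M = {B. (K, B) \<in> {(B, B'). B' \<in> N B}\<^sup>*}"
  have F\<mu>: "|Field \<mu>| <o \<kappa>" using ordLess_Field[OF mu_less_kappa] .
  have N\<kappa>: "|N B| <o \<kappa>" for B
  proof -
    have "|small B ` Field \<mu>| <o \<kappa>" using F\<mu> by (rule ordLeq_ordLess_trans[OF card_of_image])
    moreover have "|\<Union>\<nu> \<in> Field \<mu>. big B ` \<F> (cofs B \<nu>)| <o \<kappa>"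
      by (rule card_of_UNION_ordLess_infinite_Field_regularCard[OF kappa_regular kappa_Cinfinite F\<mu>])
        (intro ballI ordLeq_ordLess_trans[OF card_of_image \<F>(1)])
    ultimately show ?thesis
      unfolding N_def using kappa_Cinfinite
      by (intro card_of_Un_ordLess_infinite_Field) (simp_all add: cinfinite_def)
  qed
  have "natLeq <o \<kappa>"
    using sigma_uncountable sigma_less_mu mu_less_kappa by (blast intro: ordLess_transitive)
  then have M\<kappa>: "|M| <o \<kappa>"
    unfolding M_def by (rule card_of_reachable_less[OF kappa_Cinfinite kappa_regular _ N\<kappa>])
  have inv: "B \<subseteq> Field \<mu> \<and> |B| <o \<mu>" if "B \<in> M" for B
  proof -
    have "(K, B) \<in> {(B, B'). B' \<in> N B}\<^sup>*" using that by (simp add: M_def)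
    then show ?thesis
    proof (induction rule: rtrancl_induct)
      case base
      show ?case using K by simp
    next
      case (step B B')
      then have B: "B \<subseteq> Field \<mu>" "|B| <o \<mu>" and "B' \<in> N B" by auto
      then consider \<nu> where "\<nu> \<in> Field \<mu>" "B' = small B \<nu>" |
        \<nu> h where "h \<in> \<F> (cofs B \<nu>)" "B' = big B h" unfolding N_def by auto
      then show ?case
      proof cases
        case 1
        \<comment> \<open>Including \<open>K\<close> makes \<open>?Y\<close> infinite, so that it
          absorbs the union of the ladders.\<close>
        let ?Y = "underS \<mu> \<nu> \<union> (B \<union> K)"
        have "|?Y| <o \<mu>" using card_segment_less_mu[OF 1(1)] B(2) K(3) by (intro Un)
        moreover have "|B'| \<le>o |?Y|"
          unfolding 1(2) small_def
        proof (rule card_of_UNION_ordLeq_infinite)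
          show "infinite ?Y" using K(4) by simp
          show "|{\<beta> \<in> B. |e \<beta>| \<le>o |underS \<mu> \<nu>|}| \<le>o |?Y|" by (rule card_of_mono1) auto
          show "\<forall>\<beta> \<in> {\<beta> \<in> B. |e \<beta>| \<le>o |underS \<mu> \<nu>|}. |e \<beta>| \<le>o |?Y|"
            using card_of_mono1[of "underS \<mu> \<nu>" ?Y] ordLeq_transitive by blast
        qed
        moreover have "B' \<subseteq> Field \<mu>"
          unfolding 1(2) small_def using lad B(1) less_Field(1) unfolding ladder_def by blast
        ultimately show ?thesis using ordLeq_ordLess_trans by blast
      next
        case 2
        have "|B'| \<le>o |B|"
          unfolding 2(2) big_def
          by (rule ordLeq_transitive[OF card_of_image card_of_mono1]) auto
        moreover have "B' \<subseteq> Field \<mu>"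
          unfolding 2(2) big_def
        proof (rule image_subsetI)
          fix \<beta> assume "\<beta> \<in> {\<beta> \<in> B. infinite (e \<beta>)}"
          then have \<beta>: "\<beta> \<in> Field \<mu>" "infinite (e \<beta>)" using B(1) by auto
          have "h \<in> Prods" using 2(1) \<F>(2) by (rule rev_subsetD)
          then have "h (c \<beta>) \<prec> c \<beta>"
            using lad[OF \<beta>(1)] \<beta>(2) Prods_less unfolding ladder_def by simp
          then have "p \<beta> (h (c \<beta>)) \<prec> \<beta>" using lad[OF \<beta>(1)] \<beta>(2) unfolding ladder_def by simp
          then show "p \<beta> (h (c \<beta>)) \<in> Field \<mu>" by (rule less_Field(1))
        qed
        ultimately show ?thesis using B(2) ordLeq_ordLess_trans by blast
      qed
    qed
  qed
  have cover: "\<exists>S. S \<subseteq> M \<and> |S| <o \<sigma> \<and> X \<subseteq> \<Union>S" if X: "X \<subseteq> Field \<mu>" "|X| <o \<mu>" for X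
  proof -
    \<comment> \<open>For \<open>x\<close> outside \<open>B\<close> this is the least element of
      \<open>B\<close> above \<open>x\<close>, its current approximation; for \<open>x\<close> in
      \<open>B\<close> there is none.\<close>
    define lub where "lub B x \<beta> \<longleftrightarrow> \<beta> \<in> B \<and> x \<prec> \<beta> \<and> (\<forall>b \<in> B. x \<preceq> b \<longrightarrow> \<beta> \<preceq> b)" for B x \<beta>
    define Q where "Q B S \<longleftrightarrow> S \<subseteq> N B \<and>
        (\<forall>x \<in> X. \<forall>\<beta>. lub B x \<beta> \<longrightarrow> (\<exists>B' \<in> S. \<exists>\<beta>' \<in> B'. x \<preceq> \<beta>' \<and> \<beta>' \<prec> \<beta>))" for B S
    have step: "\<exists>S. |S| <o \<sigma> \<and> Q B S" if "B \<in> M" for B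
    proof -
      have B: "B \<subseteq> Field \<mu>" "|B| <o \<mu>" using inv[OF that] by auto
      let ?Y = "X \<union> (B \<union> K)"
      have "|?Y| <o \<mu>" using X(2) B(2) K(3) by (intro Un)
      then obtain \<nu> where \<nu>: "\<nu> \<in> Field \<mu>" "|?Y| =o |underS \<mu> \<nu>|"
        using card_less_segment_card[of ?Y] by auto
      have le\<nu>: "|S| \<le>o |underS \<mu> \<nu>|" if "S \<subseteq> ?Y" for S
        using ordLeq_ordIso_trans[OF card_of_mono1[OF that] \<nu>(2)] .
      have inf\<nu>: "infinite (underS \<mu> \<nu>)"
        using card_of_ordLeq_infinite[OF le\<nu>[of K] K(4)] by auto
      let ?A = "cofs B \<nu>"
      have AB: "|?A| \<le>o |B|"
        by (rule ordLeq_transitive[OF card_of_mono1 card_of_image[of c]]) (auto simp: cofs_def)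
      have "thin ?A"
      proof (rule thin)
        show "?A \<subseteq> Reg_below \<mu>" by (auto simp: cofs_def)
        show "|?A| <o \<mu>" using AB B(2) by (rule ordLeq_ordLess_trans)
        have "|?A| \<le>o |underS \<mu> \<nu>|" using AB le\<nu>[of B] ordLeq_transitive by blast
        then show "\<forall>a \<in> ?A. |?A| <o |underS \<mu> a|"
          unfolding cofs_def using ordLeq_ordLess_trans by blast
      qed
      then have covA: "covers (\<F> ?A) ?A" by (rule \<F>(3))
      obtain k where k: "k \<in> Prods" using Prods_nonempty by auto
      define idx where "idx x \<beta> = (SOME i. i \<prec> c \<beta> \<and> (\<forall>j. j \<prec> c \<beta> \<and> i \<preceq> j \<longrightarrow> x \<preceq> p \<beta> j))" for x \<beta>
      have idx: "idx x \<beta> \<prec> c \<beta> \<and> (\<forall>j. j \<prec> c \<beta> \<and> idx x \<beta> \<preceq> j \<longrightarrow> x \<preceq> p \<beta> j)"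
        if "\<beta> \<in> Field \<mu>" "infinite (e \<beta>)" "x \<prec> \<beta>" for x \<beta>
        unfolding idx_def
        by (rule someI_ex) (use lad[OF that(1)] that(2,3) in \<open>simp add: ladder_def\<close>)
      define m where "m x = (SOME \<beta>. lub B x \<beta>)" for x
      have m: "m x = \<beta>" if "lub B x \<beta>" for x \<beta>
      proof -
        have "lub B x (m x)" unfolding m_def using that by (rule someI)
        then show ?thesis using that leq_antisym less_imp_leq unfolding lub_def by blast
      qed
      \<comment> \<open>\<open>G x\<close> asks, at the cofinality of the approximation of
        \<open>x\<close>, for the ladder index needed to stay above \<open>x\<close>. Coordinates in
        \<open>?A\<close> exceed \<open>|X|\<close>, so one \<open>g\<close> meets the requests of
        all \<open>x\<close> there.\<close>
      define G where "G x \<gamma> = (if c (m x) = \<gamma> \<and> idx x (m x) \<prec> \<gamma> then idx x (m x) else k \<gamma>)" for x \<gamma>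
      have "\<exists>g \<in> Prods. \<forall>\<gamma> \<in> Reg_below \<mu>. |X| <o |underS \<mu> \<gamma>| \<longrightarrow> (\<forall>x \<in> X. G x \<gamma> \<prec> g \<gamma>)"
        by (rule pointwise_strict_bound) (use Prods_less[OF k] in \<open>simp add: G_def\<close>)
      then obtain g where g: "g \<in> Prods"
        "\<forall>\<gamma> \<in> Reg_below \<mu>. |X| <o |underS \<mu> \<gamma>| \<longrightarrow> (\<forall>x \<in> X. G x \<gamma> \<prec> g \<gamma>)" by (rule bexE)
      have "covered (\<F> ?A) ?A g" using covA g(1) by (simp add: covers_def)
      then obtain H \<nu>' where H: "H \<subseteq> \<F> ?A" "|H| <o \<sigma>" "\<nu>' \<in> Field \<mu>"
        "\<forall>a \<in> ?A. a \<preceq> \<nu>' \<or> (\<exists>h \<in> H. g a \<preceq> h a)" by (rule coveredE)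
      \<comment> \<open>Coordinates up to the cutoff \<open>\<nu>'\<close> may escape the covering
        of \<open>g\<close>; the ladders of such cofinality are short enough for
        \<open>small B \<nu>'\<close>.\<close>
      let ?S = "{small B \<nu>, small B \<nu>'} \<union> big B ` H"
      have "?S \<subseteq> N B" unfolding N_def using \<nu>(1) H(1,3) by auto
      moreover have "|?S| <o \<sigma>"
      proof (rule card_of_Un_ordLess_infinite_Field)
        show "infinite (Field \<sigma>)" using sigma_Cinfinite by (simp add: cinfinite_def)
        show "|{small B \<nu>, small B \<nu>'}| <o \<sigma>" by (rule finite_less_sigma) simp
        show "|big B ` H| <o \<sigma>" using H(2) by (rule ordLeq_ordLess_trans[OF card_of_image])
      qed (rule sigma_card)
      moreover have "\<exists>B' \<in> ?S. \<exists>\<beta>' \<in> B'. x \<preceq> \<beta>' \<and> \<beta>' \<prec> \<beta>" if x: "x \<in> X" and l: "lub B x \<beta>" for x \<beta>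
      proof -
        have \<beta>: "\<beta> \<in> B" "x \<prec> \<beta>" "\<beta> \<in> Field \<mu>" using l B(1) by (auto simp: lub_def)
        note L = lad[OF \<beta>(3), unfolded ladder_def]
        obtain y where y: "y \<in> e \<beta>" "x \<preceq> y" "y \<prec> \<beta>" using L \<beta>(2) by blast
        show ?thesis
        proof (cases "|e \<beta>| \<le>o |underS \<mu> \<nu>| \<or> |e \<beta>| \<le>o |underS \<mu> \<nu>'|")
          case True
          then have "y \<in> small B \<nu> \<or> y \<in> small B \<nu>'"
            unfolding small_def using \<beta>(1) y(1) by auto
          then show ?thesis using y(2,3) by auto
        next
          case False
          have inf: "infinite (e \<beta>)"
            using False finite_card_less_infinite[OF _ inf\<nu>, of "e \<beta>"] ordLess_imp_ordLeq by blast
          then have \<gamma>: "c \<beta> \<in> Reg_below \<mu>" "|e \<beta>| =o |underS \<mu> (c \<beta>)|" using L by auto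
          have lt: "|underS \<mu> \<nu>| <o |underS \<mu> (c \<beta>)|"
            using False \<gamma>(2) not_ordLeq_iff_ordLess[OF card_of_Well_order card_of_Well_order]
              ordLess_ordIso_trans by blast
          then have A: "c \<beta> \<in> ?A" using \<gamma>(1) \<beta>(1) by (simp add: cofs_def)
          have "\<not> c \<beta> \<preceq> \<nu>'"
            using False \<gamma>(2) card_segment_mono[of "c \<beta>" \<nu>'] ordIso_ordLeq_trans by blast
          then obtain h where h: "h \<in> H" "g (c \<beta>) \<preceq> h (c \<beta>)" using H(4) A by auto
          have hP: "h \<in> Prods" using subsetD[OF \<F>(2) subsetD[OF H(1) h(1)]] .
          have hc: "h (c \<beta>) \<prec> c \<beta>" using Prods_less[OF hP \<gamma>(1)] .
          have "|X| <o |underS \<mu> (c \<beta>)|" using le\<nu>[of X] lt ordLeq_ordLess_trans by blast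
          then have "G x (c \<beta>) \<prec> g (c \<beta>)" using g(2) \<gamma>(1) x by simp
          moreover have "G x (c \<beta>) = idx x \<beta>"
            using m[OF l] idx[OF \<beta>(3) inf \<beta>(2)] by (simp add: G_def)
          ultimately have "idx x \<beta> \<preceq> h (c \<beta>)" using h(2) less_imp_leq less_leq_trans by metis
          then have "x \<preceq> p \<beta> (h (c \<beta>))" using idx[OF \<beta>(3) inf \<beta>(2)] hc by simp
          moreover have "p \<beta> (h (c \<beta>)) \<prec> \<beta>" using L inf hc by simp
          moreover have "p \<beta> (h (c \<beta>)) \<in> big B h" using \<beta>(1) inf by (auto simp: big_def)
          ultimately show ?thesis using h(1) by auto
        qed
      qed
      ultimately show ?thesis unfolding Q_def by (intro exI[of _ ?S] conjI ballI allI impI)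
    qed
    have "\<forall>B. \<exists>S. |S| <o \<sigma> \<and> (B \<in> M \<longrightarrow> Q B S)"
    proof
      fix B
      show "\<exists>S. |S| <o \<sigma> \<and> (B \<in> M \<longrightarrow> Q B S)"
      proof (cases "B \<in> M")
        case True
        then show ?thesis using step[OF True] by simp
      qed (intro exI[of _ "{}"], simp add: finite_less_sigma)
    qed
    from choice[OF this] obtain nx where nx: "\<And>B. |nx B| <o \<sigma>" "\<And>B. B \<in> M \<Longrightarrow> Q B (nx B)"
      by auto
    \<comment> \<open>Closing \<open>K\<close> under \<open>nx\<close> performs all rounds at once
      and yields fewer than \<sigma> sets.\<close>
    define S where "S = {B. (K, B) \<in> {(B, B'). B' \<in> nx B}\<^sup>*}"
    have S\<sigma>: "|S| <o \<sigma>"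
      unfolding S_def
      by (rule card_of_reachable_less[OF sigma_Cinfinite sigma_regular sigma_uncountable nx(1)])
    have SM: "S \<subseteq> M"
    proof
      fix B assume "B \<in> S"
      then have "(K, B) \<in> {(B, B'). B' \<in> nx B}\<^sup>*" by (simp add: S_def)
      then show "B \<in> M"
      proof (induction rule: rtrancl_induct)
        case base
        show ?case by (simp add: M_def)
      next
        case (step B B')
        then have "B' \<in> N B" using nx(2)[of B] unfolding Q_def by auto
        with step.IH show ?case unfolding M_def by (auto intro: rtrancl_into_rtrancl)
      qed
    qed
    have "x \<in> \<Union>S" if x: "x \<in> X" for x
    proof (rule ccontr)
      assume nx': "x \<notin> \<Union>S"
      \<comment> \<open>The least point of \<open>\<Union>S\<close> at or above a missed
        \<open>x\<close> is its approximation in some \<open>B\<close> in \<open>S\<close>, and a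
        further round gives a smaller one.\<close>
      let ?T = "{\<beta> \<in> \<Union>S. x \<preceq> \<beta>}"
      have "K \<in> S" by (simp add: S_def)
      moreover obtain b where "b \<in> K" "x \<preceq> b" using K(2) X(1) x unfolding cofinal_def by blast
      ultimately have "?T \<noteq> {}" by auto
      moreover have "?T \<subseteq> Field \<mu>" using SM inv by auto
      ultimately obtain \<beta> where \<beta>: "\<beta> \<in> ?T" "\<forall>b \<in> ?T. \<beta> \<preceq> b" using least_exists[of ?T] by auto
      obtain B where B: "B \<in> S" "\<beta> \<in> B" using \<beta>(1) by auto
      have "x \<prec> \<beta>" using \<beta>(1) nx' less_or_eq[of x \<beta>] by auto
      then have "lub B x \<beta>" unfolding lub_def using B \<beta>(2) by auto
      then obtain B' \<beta>' where B': "B' \<in> nx B" "\<beta>' \<in> B'" "x \<preceq> \<beta>'" "\<beta>' \<prec> \<beta>"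
        using nx(2)[OF subsetD[OF SM B(1)]] x unfolding Q_def by blast
      have "B' \<in> S" using B(1) B'(1) unfolding S_def by (auto intro: rtrancl_into_rtrancl)
      then have "\<beta> \<preceq> \<beta>'" using \<beta>(2) B'(2,3) by auto
      then show False using B'(4) leq_less_trans less_irrefl by blast
    qed
    then show ?thesis using SM S\<sigma> by blast
  qed
  have "\<forall>X. X \<subseteq> Field \<mu> \<and> |X| <o \<mu> \<longrightarrow> (\<exists>S. S \<subseteq> M \<and> |S| <o \<sigma> \<and> X \<subseteq> \<Union>S)"
    by (intro allI impI, elim conjE) (rule cover)
  then show ?thesis using M\<kappa> inv by (intro exI[of _ M] conjI) simp_all
qed

end

section \<open>Transfer between isomorphic cardinals, and attainment of the supremum\<close>

lemma PP_Gamma_ordIso: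
  assumes "l \<in> PP_Gamma \<theta> \<sigma> \<mu>" "l =o l'"
  shows "l' \<in> PP_Gamma \<theta> \<sigma> \<mu>"
proof -
  have eq: "Card_order l \<longleftrightarrow> Card_order l'" "is_tcf \<mu> A J l \<longleftrightarrow> is_tcf \<mu> A J l'" for A J
    using assms(2) ordIso_symmetric[OF assms(2)] by (auto intro: Card_order_ordIso2 is_tcf_ordIso)
  show ?thesis using assms(1) unfolding PP_Gamma_def mem_Collect_eq eq .
qed

theorem theorem6p8:
  fixes \<sigma> :: "'b rel" and \<mu> :: "'a rel" and \<kappa> :: "'k rel"
  assumes "Card_order \<sigma>" and "regularCard \<sigma>" and "natLeq <o \<sigma>"
    and "singular \<mu>" and "\<sigma> \<le>o cofinality \<mu>"
    and "is_pp_Gamma \<mu> \<sigma> \<mu> \<kappa>" and "weakly_inaccessible \<kappa>"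
  shows "\<kappa> \<in> PP_Gamma \<mu> \<sigma> \<mu>"
proof -
  interpret pp_setting \<sigma> \<mu> by unfold_locales (fact assms)+
  let ?PP = "PP_Gamma \<mu> \<sigma> \<mu> :: ('a \<Rightarrow> 'a) rel set"
  have upper: "\<And>l. l \<in> ?PP \<Longrightarrow> l \<le>o \<kappa>"
    and least: "\<And>\<rho> :: 'k rel. Card_order \<rho> \<Longrightarrow> \<forall>l \<in> ?PP. l \<le>o \<rho> \<Longrightarrow> \<kappa> \<le>o \<rho>"
    using assms(6) unfolding is_pp_Gamma_def is_card_sup_def by simp_all
  have \<kappa>: "Card_order \<kappa>" "natLeq <o \<kappa>" "regularCard \<kappa>"
    using assms(7) by (simp_all add: weakly_inaccessible_def)
  then have inf: "Cinfinite \<kappa>"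
    using natLeq_Cinfinite cinfinite_mono ordLess_imp_ordLeq by blast
  \<comment> \<open>The sets live on \<open>'k\<close> because \<kappa> is least among the upper
    bounds on that type.\<close>
  have above: "\<exists>l \<in> ?PP. |S| <o l" if S: "|S| <o \<kappa>" for S :: "'k set"
  proof (rule ccontr)
    assume "\<not> ?thesis"
    moreover have "Well_order l" if "l \<in> ?PP" for l
      using that by (simp add: PP_Gamma_def card_order_on_def)
    ultimately have "\<forall>l \<in> ?PP. l \<le>o |S|"
      using not_ordLess_iff_ordLeq[OF _ card_of_Well_order] by blast
    then have "\<kappa> \<le>o |S|" by (rule least[OF card_of_Card_order])
    then show False using S not_ordLess_ordLeq by blast
  qed
  \<comment> \<open>Taking the empty set in \<open>above\<close> shows that \<open>?PP\<close> is
    inhabited, which places \<kappa> above \<mu>.\<close>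
  have "|{} :: 'k set| <o \<kappa>"
    using finite_iff_ordLess_natLeq[of "{} :: 'k set"] \<kappa>(2) by (auto intro: ordLess_transitive)
  from above[OF this] obtain l where "l \<in> ?PP" by (rule bexE)
  then have less: "\<mu> <o \<kappa>" using mu_less_PP[of l] upper[of l] ordLess_ordLeq_trans by blast
  interpret pp_target \<sigma> \<mu> \<kappa> by unfold_locales (fact inf \<kappa>(3) less)+
  have "\<exists>A. A \<subseteq> Reg_below \<mu> \<and> |A| <o \<mu> \<and> (\<forall>a \<in> A. |A| <o |underS \<mu> a| ) \<and> \<not> thin A"
  proof (rule ccontr)
    assume "\<not> ?thesis"
    then have "thin A" if "A \<subseteq> Reg_below \<mu>" "|A| <o \<mu>" "\<forall>a \<in> A. |A| <o |underS \<mu> a|" for A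
      using that by auto
    then obtain M where M: "|M| <o \<kappa>" "\<forall>B \<in> M. |B| <o \<mu>"
      "\<forall>X. X \<subseteq> Field \<mu> \<and> |X| <o \<mu> \<longrightarrow> (\<exists>S. S \<subseteq> M \<and> |S| <o \<sigma> \<and> X \<subseteq> \<Union>S)"
      using covering_family_exists by auto
    \<comment> \<open>A copy of \<open>M\<close> on the type \<open>'k\<close> allows
      \<open>above\<close> to supply an \<open>l\<close> in \<open>?PP\<close> larger than
      \<open>|M|\<close>.\<close>
    obtain S :: "'k set" where S: "|M| =o |S|" "|S| <o \<kappa>"
      using iffD1[OF internalize_card_of_ordLess M(1)] by blast
    obtain l where l: "l \<in> ?PP" "|S| <o l" using above[OF S(2)] by (rule bexE)
    have "|M| <o l" using S(1) l(2) by (rule ordIso_ordLess_trans)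
    then show False using covering_family_ge_PP[OF _ _ l(1), of M] M(2,3) by auto
  qed
  then obtain A where "A \<subseteq> Reg_below \<mu>" "|A| <o \<mu>" "\<forall>a \<in> A. |A| <o |underS \<mu> a|" "\<not> thin A"
    by auto
  then obtain l where l: "l \<in> ?PP" "\<kappa> \<le>o l" using not_thin_imp_large_PP[of A] by auto
  then have "l =o \<kappa>" using upper[of l] by (simp add: ordIso_iff_ordLeq)
  then show ?thesis by (rule PP_Gamma_ordIso[OF l(1)])
qed

end
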